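(* Let $\mathbf U_h(t)$, with nodal values $\mathbf U_{i_1,j_1}^{i,j}(t)\in\mathscr G$, be a solution of the two-dimensional semi-discrete nodal DG scheme described in the context, and assume the boundary conditions are periodic or compactly supported. Then the scheme is entropy conservative in each single element, in the sense that for every $i,j$ $$\begin{aligned}\frac{\mathrm d}{\mathrm dt}\Big(\frac{\Delta x\Delta y}4\sum_{i_1,j_1=0}^k\omega_{i_1}\omega_{j_1}\mathcal U(\mathbf U_{i_1,j_1}^{i,j})\Big)=&-\frac{\Delta y}2\sum_{j_1=0}^k\omega_{j_1}\big(\mathcal F_{k,j_1}^{*,i,j}-\mathcal F_{0,j_1}^{*,i,j}\big)+\frac{\Delta y}2\sum_{j_1=0}^k\omega_{j_1}\big(\mathcal F_{j_1}^{e,i+1/2,j}-\mathcal F_{j_1}^{e,i-1/2,j}\big)\\&-\frac{\Delta x}2\sum_{i_1=0}^k\omega_{i_1}\big(\mathcal G_{i_1,k}^{*,i,j}-\mathcal G_{i_1,0}^{*,i,j}\big)+\frac{\Delta x}2\sum_{i_1=0}^k\omega_{i_1}\big(\mathcal G_{i_1}^{e,i,j+1/2}-\mathcal G_{i_1}^{e,i,j-1/2}\big),\end{aligned}$$ and entropy stable in the sense that $$\frac{\mathrm d}{\mathrm dt}\Big(\frac{\Delta x\Delta y}4\sum_{i=1}^{N_x}\sum_{j=1}^{N_y}\sum_{i_1,j_1=0}^k\omega_{i_1}\omega_{j_1}\mathcal U(\mathbf U_{i_1,j_1}^{i,j})\Big)\le0,$$ where $$\mathcal F_{k,j_1}^{*,i,j}=(\mathbf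 V_{k,j_1}^{i,j})^T\mathbf F_{k,j_1}^{*,i,j}-\psi_{F,k,j_1}^{i,j},\qquad\mathcal F_{0,j_1}^{*,i,j}=(\mathbf V_{0,j_1}^{i,j})^T\mathbf F_{0,j_1}^{*,i,j}-\psi_{F,0,j_1}^{i,j},$$ $$\mathcal G_{i_1,k}^{*,i,j}=(\mathbf V_{i_1,k}^{i,j})^T\mathbf G_{i_1,k}^{*,i,j}-\psi_{G,i_1,k}^{i,j},\qquad\mathcal G_{i_1,0}^{*,i,j}=(\mathbf V_{i_1,0}^{i,j})^T\mathbf G_{i_1,0}^{*,i,j}-\psi_{G,i_1,0}^{i,j},$$ $$\mathcal F_{j_1}^{e,i\pm1/2,j}=\mathcal F(\mathbf U^e(x_{i\pm1/2},y_j(Y_{j_1}))),\qquad\mathcal G_{i_1}^{e,i,j\pm1/2}=\mathcal G(\mathbf U^e(x_i(X_{i_1}),y_{j\pm1/2})).$$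
   Context: **Equations.** 2D Euler equations with gravity $\mathbf U_t+\mathbf F(\mathbf U)_x+\mathbf G(\mathbf U)_y=\mathbf S(\mathbf U,x,y)$ on $\Omega=[a,b]\times[c,d]$, $\mathbf U=(\rho,m,n,\mathcal E)^T$, $m=\rho u$, $n=\rho v$, $\mathbf F=(m,\rho u^2+p,\rho uv,u(\mathcal E+p))^T$, $\mathbf G=(n,\rho uv,\rho v^2+p,v(\mathcal E+p))^T$, $\mathbf S=(0,-\rho\phi_x,-\rho\phi_y,-m\phi_x-n\phi_y)^T$, with given time-independent potential $\phi(x,y)$ and $\mathcal E=\frac p{\gamma-1}+\frac12\rho(u^2+v^2)$, $\gamma=1.4$. $\mathscr G=\{\mathbf U:\rho>0,\ p>0\}$. With $s=\ln(p\rho^{-\gamma})$: entropy function $\mathcal U=-\frac{\rho s}{\gamma-1}$, entropy fluxes $\mathcal F=-\frac{\rho us}{\gamma-1}$, $\mathcal G=-\frac{\rho vs}{\gamma-1}$, entropy variable $\mathbf V=\mathcal U'(\mathbf U)^T=\big(\frac{\gamma-s}{\gamma-1}-\frac{\rho(u^2+v^2)}{2p},\frac{\rho u}p,\frac{\rho v}p,-\frac\rho p\big)^T$, potential fluxes $\psi_F=\rho u$, $\psi_G=\rho v$. **Equilibrium.** $\mathbf U^e=(\rho^e,m^e,n^e,\mathcal E^e)^T:\Omega\to\mathscr G$ is a given (classical) steady state: $\mathbf F(\mathbf U^e)_x+\mathbf G(\mathbf U^e)_y=\mathbf S(\mathbf U^e,x,y)$. **Discretization.** $\Omega$ is split into $N_x\times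 N_y$ uniform rectangles $K_{ij}=[x_{i-1/2},x_{i+1/2}]\times[y_{j-1/2},y_{j+1/2}]$ with center $(x_i,y_j)$ and sizes $\Delta x,\Delta y$. $-1=X_0<\dots<X_k=1$ ($k\ge1$) are the Gauss–Lobatto points with weights $\omega_0,\dots,\omega_k$, $Y_{j_1}=X_{j_1}$; $L_l$ the Lagrange basis polynomials at these points; $D_{jl}=L_l'(X_j)$; $\tau_0=-1$, $\tau_k=1$, $\tau_j=0$ otherwise. $x_i(X)=x_i+\frac{\Delta x}2X$, $y_j(Y)=y_j+\frac{\Delta y}2Y$. The unknown $\mathbf U_h$ is a piecewise tensor-product polynomial of degree $\le k$ in each variable with nodal values $\mathbf U_{i_1,j_1}^{i,j}=\mathbf U_h|_{K_{ij}}(x_i(X_{i_1}),y_j(Y_{j_1}))$. A superscript $e$ denotes evaluation with $\mathbf U^e$ at the node; $\mathbf F_{i_1,j_1}^{i,j}=\mathbf F(\mathbf U_{i_1,j_1}^{i,j})$, and similarly for $\mathbf G,\mathbf V,\psi_F,\psi_G$. $\mathbf F^S,\mathbf G^S$ are entropy conservative fluxes: symmetric, consistent with $\mathbf F,\mathbf G$, and $(\mathbf V_R-\mathbf V_L)^T\mathbf F^S(\mathbf U_L,\mathbf U_R)=\psi_{F,R}-\psi_{F,L}$, $(\mathbf V_R-\mathbf V_L)^T\mathbf G^S(\mathbf U_L,\mathbf U_R)=\psi_{G,R}-\psi_{G,L}$. $\hat{\mathbf F}(\mathbf U_L,\mathbf U_R)=\frac12(\mathbf F(\mathbf U_L)+\mathbf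 F(\mathbf U_R))-\frac\alpha2(\mathbf U_R-\mathbf U_L)$ is the Lax–Friedrichs flux, and $\hat{\mathbf G}$ is defined analogously, with $\alpha=\alpha(\mathbf U_L,\mathbf U_R)$ in each direction chosen large enough that the fluxes are entropy stable: $(\mathbf V_R-\mathbf V_L)^T\hat{\mathbf F}(\mathbf U_L,\mathbf U_R)\le\psi_{F,R}-\psi_{F,L}$ and $(\mathbf V_R-\mathbf V_L)^T\hat{\mathbf G}(\mathbf U_L,\mathbf U_R)\le\psi_{G,R}-\psi_{G,L}$ for all $\mathbf U_L,\mathbf U_R\in\mathscr G$ (this property is assumed). $\mathbf F_{0,j_1}^{*,i,j}=\hat{\mathbf F}(\mathbf U_{k,j_1}^{i-1,j},\mathbf U_{0,j_1}^{i,j})$, $\mathbf F_{k,j_1}^{*,i,j}=\hat{\mathbf F}(\mathbf U_{k,j_1}^{i,j},\mathbf U_{0,j_1}^{i+1,j})$, $\mathbf F_{i_1,j_1}^{*,i,j}=\mathbf 0$ for $0<i_1<k$; $\mathbf G_{i_1,0}^{*,i,j}=\hat{\mathbf G}(\mathbf U_{i_1,k}^{i,j-1},\mathbf U_{i_1,0}^{i,j})$, $\mathbf G_{i_1,k}^{*,i,j}=\hat{\mathbf G}(\mathbf U_{i_1,k}^{i,j},\mathbf U_{i_1,0}^{i,j+1})$, $\mathbf G_{i_1,j_1}^{*,i,j}=\mathbf 0$ for $0<j_1<k$. **Scheme.** For all $i,j,i_1,j_1$, $$\begin{aligned}\frac{\mathrm d\mathbf U_{i_1,j_1}^{i,j}}{\mathrm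 dt}=&-\frac2{\Delta x}\sum_{l=0}^k2D_{i_1,l}\mathbf F^S(\mathbf U_{i_1,j_1}^{i,j},\mathbf U_{l,j_1}^{i,j})+\frac2{\Delta x}\frac{\tau_{i_1}}{\omega_{i_1}}(\mathbf F_{i_1,j_1}^{i,j}-\mathbf F_{i_1,j_1}^{*,i,j})\\&-\frac2{\Delta y}\sum_{l=0}^k2D_{j_1,l}\mathbf G^S(\mathbf U_{i_1,j_1}^{i,j},\mathbf U_{i_1,l}^{i,j})+\frac2{\Delta y}\frac{\tau_{j_1}}{\omega_{j_1}}(\mathbf G_{i_1,j_1}^{i,j}-\mathbf G_{i_1,j_1}^{*,i,j})\\&+\mathbf S_{i_1,j_1}^{i,j}+\mathbf S_{i_1,j_1}^{0,i,j}-\mathbf S_{i_1,j_1}^{corr,i,j},\end{aligned}$$ where $\mathbf S_{i_1,j_1}^{i,j}$ and $\mathbf S_{i_1,j_1}^{e,i,j}$ are $\mathbf S$ evaluated at the node with $\mathbf U_{i_1,j_1}^{i,j}$ and $\mathbf U_{i_1,j_1}^{e,i,j}$ respectively (using the exact $\phi_x,\phi_y$ at the node), $$\mathbf S_{i_1,j_1}^{0,i,j}=\frac2{\Delta x}\sum_{l=0}^k2D_{i_1,l}\mathbf F^S(\mathbf U_{i_1,j_1}^{e,i,j},\mathbf U_{l,j_1}^{e,i,j})+\frac2{\Delta y}\sum_{l=0}^k2D_{j_1,l}\mathbf G^S(\mathbf U_{i_1,j_1}^{e,i,j},\mathbf U_{i_1,l}^{e,i,j})-\mathbf S_{i_1,j_1}^{e,i,j},$$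 $$\mathbf S_{i_1,j_1}^{corr,i,j}=\sigma_{ij}(\mathbf V_{i_1,j_1}^{i,j}-\bar{\mathbf V}^{i,j}),\quad\bar{\mathbf V}^{i,j}=\sum_{i_1,j_1=0}^k\frac{\omega_{i_1}\omega_{j_1}}4\mathbf V_{i_1,j_1}^{i,j},\quad\sigma_{ij}=\frac{\sum_{i_1,j_1=0}^k\omega_{i_1}\omega_{j_1}(\mathbf V_{i_1,j_1}^{i,j}-\mathbf V_{i_1,j_1}^{e,i,j})^T\mathbf S_{i_1,j_1}^{0,i,j}}{\sum_{i_1,j_1=0}^k\omega_{i_1}\omega_{j_1}\|\mathbf V_{i_1,j_1}^{i,j}-\bar{\mathbf V}^{i,j}\|^2};$$ if the denominator of $\sigma_{ij}$ is zero, $\mathbf S_{i_1,j_1}^{corr,i,j}=\mathbf 0$. **Boundary conditions.** Periodic: exterior states are taken periodically in both directions and $\mathbf U^e$ is periodic on $\Omega$. Compactly supported: the boundary contributions of both the numerical solution and $\mathbf U^e$ vanish (here: on $\partial\Omega$, $\mathcal F^{*}$ and $\mathcal F(\mathbf U^e)$ at $x=a,b$, and $\mathcal G^{*}$ and $\mathcal G(\mathbf U^e)$ at $y=c,d$, are zero).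
   Formalization: Added assumption: whenever the denominator of σ_ij is zero, its numerator is also zero (at the given time, in the element for the identity, in all elements for stability); otherwise the zero correction cannot balance S^0 and the element identity fails. *)

theory Defs
  imports "HOL-Analysis.Analysis" "HOL-Computational_Algebra.Polynomial"
begin

section \<open>The two-dimensional Euler equations with gravity\<close>

text \<open>A state is \<open>(\<rho>, m, n, \<E>)\<close>: density, the two momenta and total energy.\<close>

type_synonym state = "real^4"

definition gas_gamma :: real where "gas_gamma = 1.4"

definition density :: "state \<Rightarrow> real" where "density U = U $ 1"
definition energy :: "state \<Rightarrow> real" where "energy U = U $ 4"
definition vel_u :: "state \<Rightarrow> real" where "vel_u U = U $ 2 / U $ 1"
definition vel_v :: "state \<Rightarrow> real" where "vel_v U = U $ 3 / U $ 1"

text \<open>The equation of state \<open>\<E> = p / (\<gamma> - 1) + \<rho> (u\<^sup>2 + v\<^sup>2) / 2\<close>, solved for \<open>p\<close>.\<close>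

definition pressure :: "state \<Rightarrow> real" where
  "pressure U = (gas_gamma - 1) * (energy U - density U * ((vel_u U)\<^sup>2 + (vel_v U)\<^sup>2) / 2)"

definition admissible :: "state set" where
  "admissible = {U. density U > 0 \<and> pressure U > 0}"

definition flux_F :: "state \<Rightarrow> state" where
  "flux_F U = vector [U $ 2,
     density U * (vel_u U)\<^sup>2 + pressure U,
     density U * vel_u U * vel_v U,
     vel_u U * (energy U + pressure U)]"

definition flux_G :: "state \<Rightarrow> state" where
  "flux_G U = vector [U $ 3,
     density U * vel_u U * vel_v U,
     density U * (vel_v U)\<^sup>2 + pressure U,
     vel_v U * (energy U + pressure U)]"

text \<open>The first two arguments are the values of \<open>\<phi>\<^sub>x\<close> and \<open>\<phi>\<^sub>y\<close> at the point in question.\<close>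

definition source :: "real \<Rightarrow> real \<Rightarrow> state \<Rightarrow> state" where
  "source gx gy U = vector [0, - density U * gx, - density U * gy, - U $ 2 * gx - U $ 3 * gy]"

definition spec_entropy :: "state \<Rightarrow> real" where
  "spec_entropy U = ln (pressure U * density U powr (- gas_gamma))"

definition entropy :: "state \<Rightarrow> real" where
  "entropy U = - (density U * spec_entropy U) / (gas_gamma - 1)"

definition entropy_flux_F :: "state \<Rightarrow> real" where
  "entropy_flux_F U = - (density U * vel_u U * spec_entropy U) / (gas_gamma - 1)"

definition entropy_flux_G :: "state \<Rightarrow> real" where
  "entropy_flux_G U = - (density U * vel_v U * spec_entropy U) / (gas_gamma - 1)"

definition entropy_var :: "state \<Rightarrow> state" where
  "entropy_var U = vector [
     (gas_gamma - spec_entropy U) / (gas_gamma - 1)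
       - density U * ((vel_u U)\<^sup>2 + (vel_v U)\<^sup>2) / (2 * pressure U),
     density U * vel_u U / pressure U,
     density U * vel_v U / pressure U,
     - density U / pressure U]"

definition potential_F :: "state \<Rightarrow> real" where "potential_F U = density U * vel_u U"
definition potential_G :: "state \<Rightarrow> real" where "potential_G U = density U * vel_v U"

text \<open>One-sided derivatives are meant on the boundary of the closed rectangle.\<close>

definition partial_derivatives ::
  "real \<Rightarrow> real \<Rightarrow> real \<Rightarrow> real \<Rightarrow> (real \<Rightarrow> real \<Rightarrow> real) \<Rightarrow> (real \<Rightarrow> real \<Rightarrow> real) \<Rightarrow> (real \<Rightarrow> real \<Rightarrow> real) \<Rightarrow> bool"
where
  "partial_derivatives a b c d phi phix phiy \<longleftrightarrow>
     (\<forall>x\<in>{a..b}. \<forall>y\<in>{c..d}.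
        ((\<lambda>\<xi>. phi \<xi> y) has_real_derivative phix x y) (at x within {a..b}) \<and>
        ((\<lambda>\<eta>. phi x \<eta>) has_real_derivative phiy x y) (at y within {c..d}))"

definition steady_state ::
  "real \<Rightarrow> real \<Rightarrow> real \<Rightarrow> real \<Rightarrow> (real \<Rightarrow> real \<Rightarrow> real) \<Rightarrow> (real \<Rightarrow> real \<Rightarrow> real) \<Rightarrow> (real \<Rightarrow> real \<Rightarrow> state) \<Rightarrow> bool"
where
  "steady_state a b c d phix phiy Ue \<longleftrightarrow>
     (\<forall>x\<in>{a..b}. \<forall>y\<in>{c..d}. Ue x y \<in> admissible \<and>
        (\<exists>Fx Gy.
          ((\<lambda>\<xi>. flux_F (Ue \<xi> y)) has_vector_derivative Fx) (at x within {a..b}) \<and>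
          ((\<lambda>\<eta>. flux_G (Ue x \<eta>)) has_vector_derivative Gy) (at y within {c..d}) \<and>
          Fx + Gy = source (phix x y) (phiy x y) (Ue x y)))"

section \<open>Numerical fluxes\<close>

definition entropy_conservative_flux ::
  "(state \<Rightarrow> state) \<Rightarrow> (state \<Rightarrow> real) \<Rightarrow> (state \<Rightarrow> state \<Rightarrow> state) \<Rightarrow> bool"
where
  "entropy_conservative_flux f psi fS \<longleftrightarrow>
     (\<forall>UL\<in>admissible. \<forall>UR\<in>admissible. fS UL UR = fS UR UL) \<and>
     (\<forall>U\<in>admissible. fS U U = f U) \<and>
     (\<forall>UL\<in>admissible. \<forall>UR\<in>admissible.
        (entropy_var UR - entropy_var UL) \<bullet> fS UL UR = psi UR - psi UL)"

definition lax_friedrichs ::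
  "(state \<Rightarrow> state) \<Rightarrow> (state \<Rightarrow> state \<Rightarrow> real) \<Rightarrow> state \<Rightarrow> state \<Rightarrow> state"
where
  "lax_friedrichs f \<alpha> UL UR = (1/2) *\<^sub>R (f UL + f UR) - (\<alpha> UL UR / 2) *\<^sub>R (UR - UL)"

definition entropy_stable_flux :: "(state \<Rightarrow> real) \<Rightarrow> (state \<Rightarrow> state \<Rightarrow> state) \<Rightarrow> bool" where
  "entropy_stable_flux psi fh \<longleftrightarrow>
     (\<forall>UL\<in>admissible. \<forall>UR\<in>admissible.
        (entropy_var UR - entropy_var UL) \<bullet> fh UL UR \<le> psi UR - psi UL)"

section \<open>Gauss--Lobatto quadrature and differentiation\<close>

text \<open>The Gauss--Lobatto rule on \<open>[-1, 1]\<close> is the unique \<open>(k + 1)\<close>-point rule that contains both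
  endpoints and is exact for all polynomials of degree at most \<open>2 k - 1\<close>.\<close>

definition gauss_lobatto :: "nat \<Rightarrow> (nat \<Rightarrow> real) \<Rightarrow> (nat \<Rightarrow> real) \<Rightarrow> bool" where
  "gauss_lobatto k X \<omega> \<longleftrightarrow>
     X 0 = -1 \<and> X k = 1 \<and> strict_mono_on {0..k} X \<and>
     (\<forall>q :: real poly. degree q \<le> 2 * k - 1 \<longrightarrow>
        (poly q has_integral (\<Sum>j=0..k. \<omega> j * poly q (X j))) {-1..1})"

definition lagrange_poly :: "nat \<Rightarrow> (nat \<Rightarrow> real) \<Rightarrow> nat \<Rightarrow> real poly" where
  "lagrange_poly k X l = (\<Prod>r\<in>{0..k} - {l}. smult (1 / (X l - X r)) [:- X r, 1:])"

definition diff_matrix :: "nat \<Rightarrow> (nat \<Rightarrow> real) \<Rightarrow> nat \<Rightarrow> nat \<Rightarrow> real" where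
  "diff_matrix k X j l = poly (pderiv (lagrange_poly k X l)) (X j)"

definition tau :: "nat \<Rightarrow> nat \<Rightarrow> real" where
  "tau k j = (if j = 0 then -1 else if j = k then 1 else 0)"

section \<open>The scheme\<close>

text \<open>The data of a discretisation: the rectangle \<open>[xa, xb] \<times> [yc, yd]\<close>, cell numbers, polynomial
  degree, quadrature nodes and weights, two-point fluxes, Lax--Friedrichs dissipation coefficients
  in the two directions, the two partial derivatives of the potential, and the equilibrium.\<close>

record dg_data =
  xa :: real
  xb :: real
  yc :: real
  yd :: real
  Nx :: nat
  Ny :: nat
  deg :: nat
  node :: "nat \<Rightarrow> real"
  wt :: "nat \<Rightarrow> real"
  FS :: "state \<Rightarrow> state \<Rightarrow> state"
  GS :: "state \<Rightarrow> state \<Rightarrow> state"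
  alpha_F :: "state \<Rightarrow> state \<Rightarrow> real"
  alpha_G :: "state \<Rightarrow> state \<Rightarrow> real"
  phi_x :: "real \<Rightarrow> real \<Rightarrow> real"
  phi_y :: "real \<Rightarrow> real \<Rightarrow> real"
  Ueq :: "real \<Rightarrow> real \<Rightarrow> state"

text \<open>\<open>W i j i1 j1\<close> is the value in cell \<open>(i, j)\<close> at the node \<open>(i1, j1)\<close>. Cells are numbered
  from 1; indices \<open>0\<close>, \<open>Nx + 1\<close>, \<open>Ny + 1\<close> refer to exterior states.\<close>

type_synonym nodal = "nat \<Rightarrow> nat \<Rightarrow> nat \<Rightarrow> nat \<Rightarrow> state"

definition dx :: "dg_data \<Rightarrow> real" where "dx P = (xb P - xa P) / real (Nx P)"
definition dy :: "dg_data \<Rightarrow> real" where "dy P = (yd P - yc P) / real (Ny P)"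

text \<open>\<open>x_face P i\<close> is \<open>x\<close> with index \<open>i + 1/2\<close>; \<open>x_node P i q\<close> is \<open>x\<^sub>i (X\<^sub>q)\<close>.\<close>

definition x_face :: "dg_data \<Rightarrow> nat \<Rightarrow> real" where "x_face P i = xa P + real i * dx P"
definition y_face :: "dg_data \<Rightarrow> nat \<Rightarrow> real" where "y_face P j = yc P + real j * dy P"

definition x_node :: "dg_data \<Rightarrow> nat \<Rightarrow> nat \<Rightarrow> real" where
  "x_node P i q = (xa P + (real i - 1/2) * dx P) + dx P / 2 * node P q"
definition y_node :: "dg_data \<Rightarrow> nat \<Rightarrow> nat \<Rightarrow> real" where
  "y_node P j q = (yc P + (real j - 1/2) * dy P) + dy P / 2 * node P q"

definition eq_nodal :: "dg_data \<Rightarrow> nodal" where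
  "eq_nodal P i j i1 j1 = Ueq P (x_node P i i1) (y_node P j j1)"

definition source_nodal :: "dg_data \<Rightarrow> nodal \<Rightarrow> nodal" where
  "source_nodal P W i j i1 j1 =
     source (phi_x P (x_node P i i1) (y_node P j j1)) (phi_y P (x_node P i i1) (y_node P j j1))
       (W i j i1 j1)"

definition F_star :: "dg_data \<Rightarrow> nodal \<Rightarrow> nodal" where
  "F_star P W i j i1 j1 =
     (if i1 = 0 then lax_friedrichs flux_F (alpha_F P) (W (i - 1) j (deg P) j1) (W i j 0 j1)
      else if i1 = deg P then lax_friedrichs flux_F (alpha_F P) (W i j (deg P) j1) (W (i + 1) j 0 j1)
      else 0)"

definition G_star :: "dg_data \<Rightarrow> nodal \<Rightarrow> nodal" where
  "G_star P W i j i1 j1 =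
     (if j1 = 0 then lax_friedrichs flux_G (alpha_G P) (W i (j - 1) i1 (deg P)) (W i j i1 0)
      else if j1 = deg P then lax_friedrichs flux_G (alpha_G P) (W i j i1 (deg P)) (W i (j + 1) i1 0)
      else 0)"

definition D :: "dg_data \<Rightarrow> nat \<Rightarrow> nat \<Rightarrow> real" where
  "D P = diff_matrix (deg P) (node P)"

definition volume_F :: "dg_data \<Rightarrow> nodal \<Rightarrow> nodal" where
  "volume_F P W i j i1 j1 =
     (2 / dx P) *\<^sub>R (\<Sum>l=0..deg P. (2 * D P i1 l) *\<^sub>R FS P (W i j i1 j1) (W i j l j1))"

definition volume_G :: "dg_data \<Rightarrow> nodal \<Rightarrow> nodal" where
  "volume_G P W i j i1 j1 =
     (2 / dy P) *\<^sub>R (\<Sum>l=0..deg P. (2 * D P j1 l) *\<^sub>R GS P (W i j i1 j1) (W i j i1 l))"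

definition source0 :: "dg_data \<Rightarrow> nodal" where
  "source0 P i j i1 j1 =
     volume_F P (eq_nodal P) i j i1 j1 + volume_G P (eq_nodal P) i j i1 j1
       - source_nodal P (eq_nodal P) i j i1 j1"

definition mean_var :: "dg_data \<Rightarrow> nodal \<Rightarrow> nat \<Rightarrow> nat \<Rightarrow> state" where
  "mean_var P W i j =
     (\<Sum>i1=0..deg P. \<Sum>j1=0..deg P. (wt P i1 * wt P j1 / 4) *\<^sub>R entropy_var (W i j i1 j1))"

definition sigma_num :: "dg_data \<Rightarrow> nodal \<Rightarrow> nat \<Rightarrow> nat \<Rightarrow> real" where
  "sigma_num P W i j =
     (\<Sum>i1=0..deg P. \<Sum>j1=0..deg P. wt P i1 * wt P j1 *
        ((entropy_var (W i j i1 j1) - entropy_var (eq_nodal P i j i1 j1)) \<bullet> source0 P i j i1 j1))"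

definition sigma_den :: "dg_data \<Rightarrow> nodal \<Rightarrow> nat \<Rightarrow> nat \<Rightarrow> real" where
  "sigma_den P W i j =
     (\<Sum>i1=0..deg P. \<Sum>j1=0..deg P. wt P i1 * wt P j1 *
        (norm (entropy_var (W i j i1 j1) - mean_var P W i j))\<^sup>2)"

definition source_corr :: "dg_data \<Rightarrow> nodal \<Rightarrow> nodal" where
  "source_corr P W i j i1 j1 =
     (if sigma_den P W i j = 0 then 0
      else (sigma_num P W i j / sigma_den P W i j) *\<^sub>R (entropy_var (W i j i1 j1) - mean_var P W i j))"

text \<open>If the denominator of \<open>\<sigma>\<close> vanishes, the correction is zero and cannot compensate a nonzero
  numerator, so the entropy balance of the cell breaks down (this does happen: take \<open>k = 1\<close>, one
  periodic cell with \<open>\<nabla>\<phi> \<noteq> 0\<close> at its corners, and a solution that is constant in space and moves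
  relative to the equilibrium along \<open>\<nabla>\<phi>\<close>).
  The entropy statements therefore need the equation
  \<open>\<sigma> \<cdot> denominator = numerator\<close> to be solvable for \<open>\<sigma>\<close>.\<close>

definition correction_solvable :: "dg_data \<Rightarrow> nodal \<Rightarrow> nat \<Rightarrow> nat \<Rightarrow> bool" where
  "correction_solvable P W i j \<longleftrightarrow> (sigma_den P W i j = 0 \<longrightarrow> sigma_num P W i j = 0)"

definition dg_rhs :: "dg_data \<Rightarrow> nodal \<Rightarrow> nodal" where
  "dg_rhs P W i j i1 j1 =
     - volume_F P W i j i1 j1
     + (2 / dx P * (tau (deg P) i1 / wt P i1)) *\<^sub>R (flux_F (W i j i1 j1) - F_star P W i j i1 j1)
     - volume_G P W i j i1 j1
     + (2 / dy P * (tau (deg P) j1 / wt P j1)) *\<^sub>R (flux_G (W i j i1 j1) - G_star P W i j i1 j1)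
     + source_nodal P W i j i1 j1 + source0 P i j i1 j1 - source_corr P W i j i1 j1"

definition dg_solution :: "dg_data \<Rightarrow> real set \<Rightarrow> (real \<Rightarrow> nodal) \<Rightarrow> bool" where
  "dg_solution P T U \<longleftrightarrow>
     (\<forall>t\<in>T. \<forall>i\<in>{1..Nx P}. \<forall>j\<in>{1..Ny P}. \<forall>i1\<in>{0..deg P}. \<forall>j1\<in>{0..deg P}.
        U t i j i1 j1 \<in> admissible \<and>
        ((\<lambda>s. U s i j i1 j1) has_vector_derivative dg_rhs P (U t) i j i1 j1) (at t within T))"

definition entropy_F_star :: "dg_data \<Rightarrow> nodal \<Rightarrow> nat \<Rightarrow> nat \<Rightarrow> nat \<Rightarrow> nat \<Rightarrow> real" where
  "entropy_F_star P W i j i1 j1 =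
     entropy_var (W i j i1 j1) \<bullet> F_star P W i j i1 j1 - potential_F (W i j i1 j1)"

definition entropy_G_star :: "dg_data \<Rightarrow> nodal \<Rightarrow> nat \<Rightarrow> nat \<Rightarrow> nat \<Rightarrow> nat \<Rightarrow> real" where
  "entropy_G_star P W i j i1 j1 =
     entropy_var (W i j i1 j1) \<bullet> G_star P W i j i1 j1 - potential_G (W i j i1 j1)"

section \<open>Boundary conditions\<close>

definition periodic_bc :: "dg_data \<Rightarrow> nodal \<Rightarrow> bool" where
  "periodic_bc P W \<longleftrightarrow>
     (\<forall>j\<in>{1..Ny P}. \<forall>i1\<in>{0..deg P}. \<forall>j1\<in>{0..deg P}.
        W 0 j i1 j1 = W (Nx P) j i1 j1 \<and> W (Nx P + 1) j i1 j1 = W 1 j i1 j1) \<and>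
     (\<forall>i\<in>{1..Nx P}. \<forall>i1\<in>{0..deg P}. \<forall>j1\<in>{0..deg P}.
        W i 0 i1 j1 = W i (Ny P) i1 j1 \<and> W i (Ny P + 1) i1 j1 = W i 1 i1 j1) \<and>
     (\<forall>y\<in>{yc P..yd P}. Ueq P (xa P) y = Ueq P (xb P) y) \<and>
     (\<forall>x\<in>{xa P..xb P}. Ueq P x (yc P) = Ueq P x (yd P))"

definition compact_bc :: "dg_data \<Rightarrow> nodal \<Rightarrow> bool" where
  "compact_bc P W \<longleftrightarrow>
     (\<forall>j\<in>{1..Ny P}. \<forall>j1\<in>{0..deg P}.
        entropy_F_star P W 1 j 0 j1 = 0 \<and> entropy_F_star P W (Nx P) j (deg P) j1 = 0) \<and>
     (\<forall>i\<in>{1..Nx P}. \<forall>i1\<in>{0..deg P}.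
        entropy_G_star P W i 1 i1 0 = 0 \<and> entropy_G_star P W i (Ny P) i1 (deg P) = 0) \<and>
     (\<forall>y\<in>{yc P..yd P}. entropy_flux_F (Ueq P (xa P) y) = 0 \<and> entropy_flux_F (Ueq P (xb P) y) = 0) \<and>
     (\<forall>x\<in>{xa P..xb P}. entropy_flux_G (Ueq P x (yc P)) = 0 \<and> entropy_flux_G (Ueq P x (yd P)) = 0)"

end

theory Submission
  imports Defs
begin

text \<open>
  Exactness of the Gauss--Lobatto rule gives summation by parts for the differentiation matrix.
  Combined with the symmetry of an entropy conservative flux it turns every volume term, tested
  against the entropy variable of its own state, into a difference of the exact entropy flux over
  the cell; the surface terms then replace this exact flux by the numerical one. The gravity source
  is orthogonal to the entropy variable. The remaining term \<open>source0\<close>, tested against \<open>V\<close>, is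
  modified by the correction so as to act as if tested against the equilibrium variable, where the
  volume identity yields the entropy flux differences of the equilibrium. Summed over the cells, the
  equilibrium fluxes telescope and entropy stability signs the jump at each interface.
\<close>

section \<open>Gauss--Lobatto summation by parts\<close>

lemma gauss_lobatto_exact:
  assumes "gauss_lobatto k X w" "degree q \<le> 2 * k - 1"
  shows "(poly q has_integral (\<Sum>j=0..k. w j * poly q (X j))) {-1..1}"
  using assms by (simp add: gauss_lobatto_def)

lemma gauss_lobatto_endpoints:
  assumes "gauss_lobatto k X w"
  shows "X 0 = -1" "X k = 1"
  using assms by (simp_all add: gauss_lobatto_def)

lemma gauss_lobatto_inj:
  assumes "gauss_lobatto k X w"
  shows "inj_on X {0..k}"
  using assms by (auto simp: gauss_lobatto_def intro: strict_mono_on_imp_inj_on)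

lemma gauss_lobatto_node_bounds:
  assumes "gauss_lobatto k X w" "i \<le> k"
  shows "-1 \<le> X i" "X i \<le> 1"
proof -
  have mono: "mono_on {0..k} X"
    using assms by (auto simp: gauss_lobatto_def intro: strict_mono_on_imp_mono_on)
  have "X 0 \<le> X i" "X i \<le> X k"
    using assms(2) by (auto intro!: mono_onD[OF mono])
  then show "-1 \<le> X i" "X i \<le> 1"
    using gauss_lobatto_endpoints[OF assms(1)] by auto
qed

section \<open>Lagrange basis polynomials and the differentiation matrix\<close>

lemma poly_lagrange_poly:
  assumes "inj_on X {0..k}" "l \<le> k" "j \<le> k"
  shows "poly (lagrange_poly k X l) (X j) = (if j = l then 1 else 0)"
proof (cases "j = l")
  case True
  have "X l - X r \<noteq> 0" if "r \<in> {0..k} - {l}" for r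
    using that assms inj_onD[OF assms(1), of l r] by auto
  then show ?thesis
    using True by (auto simp: lagrange_poly_def poly_prod divide_simps intro!: prod.neutral)
next
  case False
  then show ?thesis
    using assms(3) by (auto simp: lagrange_poly_def poly_prod intro!: bexI[of _ j])
qed

lemma degree_lagrange_poly:
  assumes "l \<le> k"
  shows "degree (lagrange_poly k X l) \<le> k"
proof -
  let ?f = "\<lambda>r. smult (1 / (X l - X r)) [:- X r, 1:]"
  have "degree (lagrange_poly k X l) \<le> (\<Sum>r\<in>{0..k} - {l}. degree (?f r))"
    unfolding lagrange_poly_def using degree_prod_sum_le[of "{0..k} - {l}" ?f] by simp
  also have "\<dots> \<le> (\<Sum>r\<in>{0..k} - {l}. 1)"
    by (intro sum_mono) (auto intro: order.trans[OF degree_smult_le])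
  also have "\<dots> = k" using assms by simp
  finally show ?thesis .
qed

text \<open>Both sides have degree at most \<open>k\<close> and take the value 1 at the
  \<open>k + 1\<close> distinct nodes.\<close>

lemma lagrange_poly_sum:
  assumes "inj_on X {0..k}"
  shows "(\<Sum>l=0..k. lagrange_poly k X l) = 1"
proof (rule poly_eqI_degree)
  fix x assume "x \<in> X ` {0..k}"
  then obtain j where "j \<le> k" "x = X j" by auto
  then show "poly (\<Sum>l=0..k. lagrange_poly k X l) x = poly 1 x"
    using assms by (simp add: poly_sum poly_lagrange_poly)
next
  have "degree (\<Sum>l=0..k. lagrange_poly k X l) \<le> k"
    by (intro degree_sum_le) (auto intro: degree_lagrange_poly)
  then show "degree (\<Sum>l=0..k. lagrange_poly k X l) < card (X ` {0..k})"
    using assms by (simp add: card_image)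
  show "degree (1 :: real poly) < card (X ` {0..k})"
    using assms by (simp add: card_image)
qed

lemma diff_matrix_row_sum:
  assumes "inj_on X {0..k}"
  shows "(\<Sum>l=0..k. diff_matrix k X j l) = 0"
proof -
  have "(\<Sum>l=0..k. diff_matrix k X j l) = poly (pderiv (\<Sum>l=0..k. lagrange_poly k X l)) (X j)"
    \<comment> \<open>At order 1 this is additivity of \<open>pderiv\<close>; the row sum is thus
      the derivative of the constant 1.\<close>
    using higher_pderiv_sum[of 1 "lagrange_poly k X" "{0..k}"]
    by (simp add: diff_matrix_def poly_sum)
  then show ?thesis
    by (simp add: lagrange_poly_sum[OF assms])
qed

text \<open>Integration by parts for a product of two basis polynomials. The derivative of the
  product has degree at most \<open>2 * k - 1\<close>, so the quadrature integrates it exactly, and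
  the fundamental theorem of calculus leaves values at the two end nodes.\<close>

lemma diff_matrix_summation_by_parts:
  assumes gl: "gauss_lobatto k X w" and k: "k \<ge> 1" and i: "i \<le> k" and l: "l \<le> k"
  shows "w i * diff_matrix k X i l + w l * diff_matrix k X l i = (if i = l then tau k i else 0)"
proof -
  note inj = gauss_lobatto_inj[OF gl]
  let ?p = "lagrange_poly k X i * lagrange_poly k X l"
  have "degree ?p \<le> k + k"
    by (intro order.trans[OF degree_mult_le] add_mono degree_lagrange_poly i l)
  then have "degree (pderiv ?p) \<le> 2 * k - 1"
    by (simp add: degree_pderiv)
  then have "(poly (pderiv ?p) has_integral (\<Sum>j=0..k. w j * poly (pderiv ?p) (X j))) {-1..1}"
    by (rule gauss_lobatto_exact[OF gl])
  moreover have "(poly (pderiv ?p) has_integral poly ?p 1 - poly ?p (-1)) {-1..1}"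
    by (intro fundamental_theorem_of_calculus)
      (auto simp del: poly_mult simp flip: has_real_derivative_iff_has_vector_derivative
        intro: DERIV_subset[OF poly_DERIV])
  ultimately have "(\<Sum>j=0..k. w j * poly (pderiv ?p) (X j)) = poly ?p 1 - poly ?p (-1)"
    by (rule has_integral_unique)
  also have "poly ?p 1 - poly ?p (-1) = poly ?p (X k) - poly ?p (X 0)"
    by (simp add: gauss_lobatto_endpoints[OF gl])
  also have "\<dots> = (if i = l then tau k i else 0)"
    using i l k by (auto simp: poly_lagrange_poly[OF inj] tau_def)
  \<comment> \<open>In the product rule, the undifferentiated factor is a Kronecker delta at the
    nodes, so each of the two terms survives at a single node.\<close>
  also have "(\<Sum>j=0..k. w j * poly (pderiv ?p) (X j)) =
      (\<Sum>j=0..k. (if j = i then w j * diff_matrix k X j l else 0)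
        + (if j = l then w j * diff_matrix k X j i else 0))"
    using i l by (intro sum.cong refl)
      (auto simp: pderiv_mult poly_lagrange_poly[OF inj] diff_matrix_def algebra_simps)
  also have "\<dots> = w i * diff_matrix k X i l + w l * diff_matrix k X l i"
    using i l by (simp add: sum.distrib sum.delta)
  finally show ?thesis .
qed

section \<open>Sum and positivity of the quadrature weights\<close>

lemma gauss_lobatto_weight_sum:
  assumes gl: "gauss_lobatto k X w"
  shows "(\<Sum>i=0..k. w i) = 2"
proof -
  have "((\<lambda>x. 1) has_integral (\<Sum>i=0..k. w i)) {-1..1::real}"
    using gauss_lobatto_exact[OF gl, of 1] by (simp add: poly_1[abs_def])
  moreover have "((\<lambda>x. 1) has_integral (2::real)) {-1..1::real}"
    using has_integral_const_real[of "1::real" "-1" 1] by simp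
  ultimately show ?thesis
    by (rule has_integral_unique)
qed

text \<open>The test polynomial vanishes at every node but \<open>X l\<close>. It is nonnegative on \<open>[-1, 1]\<close> with the
  endpoints as simple roots, which keeps its degree within the range of exactness.\<close>

lemma gauss_lobatto_weight_pos:
  assumes gl: "gauss_lobatto k X w" and k: "k \<ge> 1" and l: "l \<le> k"
  shows "w l > 0"
proof -
  define e where "e r = (if r = 0 then [:1, 1:] else if r = k then [:1, -1:]
    else [:- X r, 1:]^2)" for r
  define q where "q = (\<Prod>r\<in>{0..k} - {l}. e r)"
  note inj = gauss_lobatto_inj[OF gl] and ends = gauss_lobatto_endpoints[OF gl]
  have e_nonneg: "poly (e r) x \<ge> 0" if "x \<in> {-1..1}" for r x
    using that by (auto simp: e_def)
  have e_zero: "poly (e r) (X r) = 0" for r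
    using ends by (auto simp: e_def)
  have e_nonzero: "poly (e r) (X j) \<noteq> 0" if "r \<le> k" "j \<le> k" "r \<noteq> j" for r j
    using inj_onD[OF inj, of j r] inj_onD[OF inj, of j 0] inj_onD[OF inj, of j k] that ends
    by (auto simp: e_def)
  have deg_e: "degree (e r) = (if r = 0 \<or> r = k then 1 else 2)" for r
    by (auto simp: e_def degree_power_eq)
  have "degree q \<le> (\<Sum>r\<in>{0..k} - {l}. degree (e r))"
    unfolding q_def using degree_prod_sum_le[of "{0..k} - {l}" e] by (simp add: o_def)
  also have "\<dots> = (\<Sum>r=0..k. degree (e r)) - degree (e l)"
    using l by (simp add: sum_diff1_nat)
  \<comment> \<open>Each factor has degree at least 1, so omitting \<open>e l\<close> lowers the
    full degree \<open>2 * k\<close> to the limit of exactness.\<close>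
  also have "\<dots> \<le> (\<Sum>r=0..k. degree (e r)) - 1"
    by (auto simp: deg_e intro: diff_le_mono2)
  also have "(\<Sum>r=0..k. degree (e r)) = 2 * k"
  proof -
    have "{0..k} = insert 0 (insert k {1..<k})" using k by auto
    then show ?thesis using k by (simp add: deg_e)
  qed
  finally have "(poly q has_integral (\<Sum>j=0..k. w j * poly q (X j))) {-1..1}"
    by (rule gauss_lobatto_exact[OF gl])
  moreover have "(\<Sum>j=0..k. w j * poly q (X j)) = (\<Sum>j=0..k. if j = l then w l * poly q (X l) else 0)"
    using e_zero by (intro sum.cong refl) (fastforce simp: q_def poly_prod)
  ultimately have int: "(poly q has_integral w l * poly q (X l)) {-1..1}"
    using l by simp
  have q_nonneg: "poly q x \<ge> 0" if "x \<in> {-1..1}" for x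
    using e_nonneg[OF that] by (auto simp: q_def poly_prod intro: prod_nonneg)
  have q_nonzero: "poly q (X l) \<noteq> 0"
    using e_nonzero l by (auto simp: q_def poly_prod)
  have X_l: "X l \<in> {-1..1}"
    using gauss_lobatto_node_bounds[OF gl l] by simp
  have "continuous_on {-1..1} (poly q)"
    by (intro continuous_at_imp_continuous_on ballI poly_isCont)
  \<comment> \<open>A continuous nonnegative function with zero integral vanishes identically, but
    \<open>q\<close> is nonzero at \<open>X l\<close>.\<close>
  then have "integral {-1..1} (poly q) \<noteq> 0"
    using integral_eq_0_iff[of "-1" 1 "poly q"] q_nonneg q_nonzero X_l by auto
  moreover have "integral {-1..1} (poly q) \<ge> 0"
    using q_nonneg by (intro integral_nonneg has_integral_integrable[OF int])
  ultimately have "w l * poly q (X l) > 0"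
    using integral_unique[OF int] by linarith
  then show ?thesis
    using q_nonneg[OF X_l] by (simp add: zero_less_mult_iff)
qed

text \<open>Sum the summation-by-parts identity over the row index; the transposed term becomes a
  row sum, which is zero.\<close>

lemma diff_matrix_column_sum:
  assumes gl: "gauss_lobatto k X w" and k: "k \<ge> 1" and l: "l \<le> k"
  shows "(\<Sum>i=0..k. w i * diff_matrix k X i l) = tau k l"
proof -
  have "(\<Sum>i=0..k. w i * diff_matrix k X i l) =
      (\<Sum>i=0..k. (if i = l then tau k i else 0) - w l * diff_matrix k X l i)"
    using diff_matrix_summation_by_parts[OF gl k _ l] by (intro sum.cong refl) (auto simp: algebra_simps)
  then show ?thesis
    using l by (simp add: sum_subtractf diff_matrix_row_sum[OF gauss_lobatto_inj[OF gl]]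
        flip: sum_distrib_left)
qed

section \<open>Discrete boundary evaluation and flux differencing\<close>

lemma sum_tau:
  assumes "k \<ge> 1"
  shows "(\<Sum>i=0..k. tau k i * g i) = g k - g 0"
proof -
  have "{0..k} = insert 0 (insert k {1..<k})" using assms by auto
  then show ?thesis using assms by (simp add: tau_def)
qed

text \<open>Symmetry of \<open>f\<close> lets one half of \<open>2 w D\<close> be replaced by its transpose, after which only
  differences \<open>v i - v l\<close> are tested against \<open>f i l\<close>.\<close>

lemma flux_differencing_telescopes:
  fixes v :: "nat \<Rightarrow> 'a :: real_inner"
  assumes gl: "gauss_lobatto k X w" and k: "k \<ge> 1"
    and sym: "\<And>i l. i \<le> k \<Longrightarrow> l \<le> k \<Longrightarrow> f i l = f l i"
    and shuffle: "\<And>i l. i \<le> k \<Longrightarrow> l \<le> k \<Longrightarrow> (v l - v i) \<bullet> f i l = psi l - psi i"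
  shows "(\<Sum>i=0..k. w i * (v i \<bullet> (\<Sum>l=0..k. (2 * diff_matrix k X i l) *\<^sub>R f i l)))
    = (v k \<bullet> f k k - psi k) - (v 0 \<bullet> f 0 0 - psi 0)"
proof -
  let ?Q = "\<lambda>i l. w i * diff_matrix k X i l"
  let ?S = "\<Sum>i=0..k. \<Sum>l=0..k. ?Q i l * (v i \<bullet> f i l)"
  let ?S' = "\<Sum>i=0..k. \<Sum>l=0..k. ?Q i l * (v l \<bullet> f i l)"
  have double: "(\<Sum>i=0..k. w i * (v i \<bullet> (\<Sum>l=0..k. (2 * diff_matrix k X i l) *\<^sub>R f i l))) = ?S + ?S"
    by (simp add: inner_sum_right sum_distrib_left sum.distrib[symmetric] algebra_simps)
  have "?S = (\<Sum>i=0..k. \<Sum>l=0..k. (if i = l then tau k i * (v i \<bullet> f i i) else 0) - ?Q l i * (v i \<bullet> f l i))"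
  proof (intro sum.cong refl)
    fix i l assume "i \<in> {0..k}" "l \<in> {0..k}"
    then have Q: "?Q i l = (if i = l then tau k i else 0) - ?Q l i" and f: "f i l = f l i"
      using diff_matrix_summation_by_parts[OF gl k, of i l] sym by auto
    show "?Q i l * (v i \<bullet> f i l) = (if i = l then tau k i * (v i \<bullet> f i i) else 0) - ?Q l i * (v i \<bullet> f l i)"
      unfolding Q f by (simp add: left_diff_distrib)
  qed
  also have "\<dots> = (\<Sum>i=0..k. tau k i * (v i \<bullet> f i i)) - ?S'"
    \<comment> \<open>Exchanging the order of summation in the transposed sum exhibits it as
      \<open>?S'\<close> with its two indices renamed.\<close>
    by (subst (2) sum.swap) (simp add: sum_subtractf)
  finally have transpose: "?S = (\<Sum>i=0..k. tau k i * (v i \<bullet> f i i)) - ?S'" .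
  have "?S - ?S' = (\<Sum>i=0..k. \<Sum>l=0..k. ?Q i l * (psi i - psi l))"
    unfolding sum_subtractf[symmetric]
  proof (intro sum.cong refl)
    fix i l assume "i \<in> {0..k}" "l \<in> {0..k}"
    then have "v i \<bullet> f i l - v l \<bullet> f i l = psi i - psi l"
      using shuffle[of i l] by (simp add: inner_diff_left)
    then show "?Q i l * (v i \<bullet> f i l) - ?Q i l * (v l \<bullet> f i l) = ?Q i l * (psi i - psi l)"
      by (simp flip: right_diff_distrib)
  qed
  \<comment> \<open>The \<open>psi i\<close> part collects row sums, which vanish; the
    \<open>psi l\<close> part collects column sums, which are \<open>tau\<close>.\<close>
  also have "\<dots> = (\<Sum>i=0..k. w i * psi i * (\<Sum>l=0..k. diff_matrix k X i l))
      - (\<Sum>l=0..k. (\<Sum>i=0..k. ?Q i l) * psi l)"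
    unfolding sum_distrib_right by (subst (2) sum.swap)
      (simp add: sum_distrib_left sum_subtractf algebra_simps)
  also have "\<dots> = - (\<Sum>l=0..k. tau k l * psi l)"
    by (simp add: diff_matrix_row_sum[OF gauss_lobatto_inj[OF gl]]
        diff_matrix_column_sum[OF gl k])
  \<comment> \<open>The sum and the difference of \<open>?S\<close> and \<open>?S'\<close> are now
    both boundary terms; adding the two equations eliminates \<open>?S'\<close>.\<close>
  finally have "?S + ?S = (\<Sum>i=0..k. tau k i * (v i \<bullet> f i i)) - (\<Sum>l=0..k. tau k l * psi l)"
    using transpose by simp
  then show ?thesis
    unfolding double by (simp add: sum_tau[OF k])
qed

text \<open>The positive quadrature weight cancels the division by \<open>w i\<close>, and
  \<open>tau\<close> then selects the two end nodes.\<close>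

lemma sum_surface_term:
  fixes v :: "nat \<Rightarrow> 'a :: real_inner"
  assumes gl: "gauss_lobatto k X w" and k: "k \<ge> 1"
  shows "(\<Sum>i=0..k. w i * (v i \<bullet> ((c * (tau k i / w i)) *\<^sub>R g i))) = c * (v k \<bullet> g k - v 0 \<bullet> g 0)"
proof -
  have "(\<Sum>i=0..k. w i * (v i \<bullet> ((c * (tau k i / w i)) *\<^sub>R g i))) = (\<Sum>i=0..k. tau k i * (c * (v i \<bullet> g i)))"
  proof (intro sum.cong refl)
    fix i assume "i \<in> {0..k}"
    then show "w i * (v i \<bullet> ((c * (tau k i / w i)) *\<^sub>R g i)) = tau k i * (c * (v i \<bullet> g i))"
      using gauss_lobatto_weight_pos[OF gl k, of i] by simp
  qed
  then show ?thesis
    by (simp add: sum_tau[OF k, of "\<lambda>i. c * (v i \<bullet> g i)"] right_diff_distrib)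
qed

section \<open>Entropy identities for the Euler equations\<close>

lemma vector_4 [simp]:
  "(vector [x, y, z, w] :: ('a::zero)^4) $ 1 = x"
  "(vector [x, y, z, w] :: ('a::zero)^4) $ 2 = y"
  "(vector [x, y, z, w] :: ('a::zero)^4) $ 3 = z"
  "(vector [x, y, z, w] :: ('a::zero)^4) $ 4 = w"
  unfolding vector_def by simp_all

lemma inner_real_4: "(x :: real^4) \<bullet> y = x$1 * y$1 + x$2 * y$2 + x$3 * y$3 + x$4 * y$4"
  by (simp add: inner_vec_def sum_4)

text \<open>The equation of state in its usual form, used to express the fluxes through density,
  velocity and pressure.\<close>

lemma energy_eq: "energy U = pressure U / (gas_gamma - 1) + density U * ((vel_u U)\<^sup>2 + (vel_v U)\<^sup>2) / 2"
  by (simp add: pressure_def gas_gamma_def field_simps)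

text \<open>The relation between entropy variable, flux, entropy flux and potential flux. It is
  rational algebra in density, velocity and pressure, with the logarithm
  \<open>spec_entropy U\<close> kept as an atom.\<close>

lemma entropy_var_inner_flux_F:
  assumes "U \<in> admissible"
  shows "entropy_var U \<bullet> flux_F U = entropy_flux_F U + potential_F U"
proof -
  have pos: "density U > 0" "pressure U > 0" using assms by (auto simp: admissible_def)
  then have mom: "U $ 2 = density U * vel_u U"
    by (simp add: vel_u_def density_def)
  show ?thesis
    using pos unfolding inner_real_4 entropy_var_def flux_F_def vector_4 mom energy_eq[of U]
    by (simp add: entropy_flux_F_def potential_F_def gas_gamma_def field_simps power2_eq_square)
qed

lemma entropy_var_inner_flux_G:
  assumes "U \<in> admissible"
  shows "entropy_var U \<bullet> flux_G U = entropy_flux_G U + potential_G U"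
proof -
  have pos: "density U > 0" "pressure U > 0" using assms by (auto simp: admissible_def)
  then have mom: "U $ 3 = density U * vel_v U"
    by (simp add: vel_v_def density_def)
  show ?thesis
    using pos unfolding inner_real_4 entropy_var_def flux_G_def vector_4 mom energy_eq[of U]
    by (simp add: entropy_flux_G_def potential_G_def gas_gamma_def field_simps power2_eq_square)
qed

text \<open>The work of gravity in the energy component cancels its contributions to the two
  momentum components. Hence neither the source of the solution nor that of the equilibrium enters
  the balance.\<close>

lemma entropy_var_inner_source:
  assumes "U \<in> admissible"
  shows "entropy_var U \<bullet> source gx gy U = 0"
proof -
  have pos: "density U > 0" "pressure U > 0" using assms by (auto simp: admissible_def)
  then have mom: "U $ 2 = density U * vel_u U" "U $ 3 = density U * vel_v U"
    by (simp_all add: vel_u_def vel_v_def density_def)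
  show ?thesis
    using pos unfolding inner_real_4 entropy_var_def source_def vector_4 mom
    by (simp add: field_simps)
qed

section \<open>Time derivative of the entropy\<close>

lemma has_vector_derivative_vec_nth:
  assumes "(f has_vector_derivative f') (at t within T)"
  shows "((\<lambda>s. f s $ i) has_real_derivative f' $ i) (at t within T)"
  unfolding has_real_derivative_iff_has_vector_derivative
  using bounded_linear.has_vector_derivative[OF bounded_linear_vec_nth assms] .

text \<open>The entropy variable is the gradient of the entropy. The chain rule is carried out along
  the curve \<open>f\<close>, successively for velocity, pressure and specific entropy.\<close>

lemma has_real_derivative_entropy:
  assumes adm: "f t \<in> admissible" and f: "(f has_vector_derivative f') (at t within T)"
  shows "((\<lambda>s. entropy (f s)) has_real_derivative entropy_var (f t) \<bullet> f') (at t within T)"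
proof -
  have pos: "density (f t) > 0" "pressure (f t) > 0" using adm by (auto simp: admissible_def)
  note comp = has_vector_derivative_vec_nth[OF f]
  let ?u = "vel_u (f t)" and ?v = "vel_v (f t)" and ?r = "density (f t)" and ?p = "pressure (f t)"
  have r: "((\<lambda>s. density (f s)) has_real_derivative f' $ 1) (at t within T)"
    using comp by (simp add: density_def)
  have u: "((\<lambda>s. vel_u (f s)) has_real_derivative (f' $ 2 - ?u * f' $ 1) / ?r) (at t within T)"
    unfolding vel_u_def density_def
    by (rule derivative_eq_intros comp)+ (use pos in \<open>auto simp: density_def field_simps power2_eq_square\<close>)
  have v: "((\<lambda>s. vel_v (f s)) has_real_derivative (f' $ 3 - ?v * f' $ 1) / ?r) (at t within T)"
    unfolding vel_v_def density_def
    by (rule derivative_eq_intros comp)+ (use pos in \<open>auto simp: density_def field_simps power2_eq_square\<close>)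
  \<comment> \<open>The derivative of \<open>(gas_gamma - 1)\<close> times energy minus
    \<open>(m^2 + n^2) / (2 * density)\<close>, with the momenta \<open>m\<close>, \<open>n\<close>
    written through the velocities.\<close>
  define p' where "p' = (gas_gamma - 1) *
    (f' $ 4 - ?u * f' $ 2 - ?v * f' $ 3 + (?u\<^sup>2 + ?v\<^sup>2) / 2 * f' $ 1)"
  have p: "((\<lambda>s. pressure (f s)) has_real_derivative p') (at t within T)"
    unfolding pressure_def energy_def
    by (rule DERIV_cong[OF DERIV_cmult[OF DERIV_diff[OF comp DERIV_cdivide[OF DERIV_mult[OF r
            DERIV_add[OF DERIV_power[OF u, of 2] DERIV_power[OF v, of 2]]]]]]])
      (use pos in \<open>simp add: p'_def field_simps power2_eq_square\<close>)
  \<comment> \<open>The logarithmic derivative of the pressure minus \<open>gas_gamma\<close> times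
    that of the density.\<close>
  define s' where "s' = p' / ?p - gas_gamma * f' $ 1 / ?r"
  have "((\<lambda>s. ln (pressure (f s) * density (f s) powr - gas_gamma)) has_real_derivative
      1 / (?p * ?r powr - gas_gamma) *
        (p' * ?r powr - gas_gamma + - gas_gamma * ?r powr (- gas_gamma - 1) * f' $ 1 * ?p)) (at t within T)"
    using pos by (intro DERIV_chain2[OF DERIV_ln_divide] DERIV_mult[OF p]
        DERIV_chain2[OF has_real_derivative_powr r] mult_pos_pos) auto
  also have "1 / (?p * ?r powr - gas_gamma) *
        (p' * ?r powr - gas_gamma + - gas_gamma * ?r powr (- gas_gamma - 1) * f' $ 1 * ?p) = s'"
    using pos by (simp add: s'_def powr_diff field_simps)
  finally have s: "((\<lambda>s. spec_entropy (f s)) has_real_derivative s') (at t within T)"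
    by (simp add: spec_entropy_def)
  have "((\<lambda>s. entropy (f s)) has_real_derivative
      - (f' $ 1 * spec_entropy (f t) + s' * ?r) / (gas_gamma - 1)) (at t within T)"
    unfolding entropy_def
    by (rule DERIV_cong[OF DERIV_cdivide[OF DERIV_minus[OF DERIV_mult[OF r s]]]]) (simp add: algebra_simps)
  also have "- (f' $ 1 * spec_entropy (f t) + s' * ?r) / (gas_gamma - 1) = entropy_var (f t) \<bullet> f'"
    using pos unfolding inner_real_4 entropy_var_def vector_4 s'_def p'_def
    by (simp add: gas_gamma_def field_simps power2_eq_square)
  finally show ?thesis .
qed

section \<open>Entropy balance of one cell\<close>

locale dg_scheme =
  fixes P :: dg_data
  assumes degree: "deg P \<ge> 1"
    and quadrature: "gauss_lobatto (deg P) (node P) (wt P)"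
    and FS_conservative: "entropy_conservative_flux flux_F potential_F (FS P)"
    and GS_conservative: "entropy_conservative_flux flux_G potential_G (GS P)"
begin

text \<open>Flux differencing along one line of nodes in the \<open>x\<close> direction. Consistency
  replaces the diagonal two-point fluxes by exact ones. \<open>W\<close> is arbitrary because both
  the solution and the equilibrium are inserted later.\<close>

lemma volume_F_entropy:
  assumes "\<And>i1. i1 \<le> deg P \<Longrightarrow> W i j i1 j1 \<in> admissible"
  shows "(\<Sum>i1=0..deg P. wt P i1 * (entropy_var (W i j i1 j1) \<bullet> volume_F P W i j i1 j1))
    = 2 / dx P * (entropy_flux_F (W i j (deg P) j1) - entropy_flux_F (W i j 0 j1))"
proof -
  let ?V = "\<lambda>i1. entropy_var (W i j i1 j1)"
  have "(\<Sum>i1=0..deg P. wt P i1 * (?V i1 \<bullet> volume_F P W i j i1 j1)) =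
      2 / dx P * (\<Sum>i1=0..deg P. wt P i1 *
        (?V i1 \<bullet> (\<Sum>l=0..deg P. (2 * diff_matrix (deg P) (node P) i1 l) *\<^sub>R FS P (W i j i1 j1) (W i j l j1))))"
    by (simp add: volume_F_def D_def sum_distrib_left mult_ac)
  also have "\<dots> = 2 / dx P *
      ((?V (deg P) \<bullet> FS P (W i j (deg P) j1) (W i j (deg P) j1) - potential_F (W i j (deg P) j1))
       - (?V 0 \<bullet> FS P (W i j 0 j1) (W i j 0 j1) - potential_F (W i j 0 j1)))"
    using FS_conservative assms
    by (subst flux_differencing_telescopes[OF quadrature degree, where psi = "\<lambda>i1. potential_F (W i j i1 j1)"])
      (auto simp: entropy_conservative_flux_def)
  finally show ?thesis
    using FS_conservative assms by (simp add: entropy_conservative_flux_def entropy_var_inner_flux_F)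
qed

lemma volume_G_entropy:
  assumes "\<And>j1. j1 \<le> deg P \<Longrightarrow> W i j i1 j1 \<in> admissible"
  shows "(\<Sum>j1=0..deg P. wt P j1 * (entropy_var (W i j i1 j1) \<bullet> volume_G P W i j i1 j1))
    = 2 / dy P * (entropy_flux_G (W i j i1 (deg P)) - entropy_flux_G (W i j i1 0))"
proof -
  let ?V = "\<lambda>j1. entropy_var (W i j i1 j1)"
  have "(\<Sum>j1=0..deg P. wt P j1 * (?V j1 \<bullet> volume_G P W i j i1 j1)) =
      2 / dy P * (\<Sum>j1=0..deg P. wt P j1 *
        (?V j1 \<bullet> (\<Sum>l=0..deg P. (2 * diff_matrix (deg P) (node P) j1 l) *\<^sub>R GS P (W i j i1 j1) (W i j i1 l))))"
    by (simp add: volume_G_def D_def sum_distrib_left mult_ac)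
  also have "\<dots> = 2 / dy P *
      ((?V (deg P) \<bullet> GS P (W i j i1 (deg P)) (W i j i1 (deg P)) - potential_G (W i j i1 (deg P)))
       - (?V 0 \<bullet> GS P (W i j i1 0) (W i j i1 0) - potential_G (W i j i1 0)))"
    using GS_conservative assms
    by (subst flux_differencing_telescopes[OF quadrature degree, where psi = "\<lambda>j1. potential_G (W i j i1 j1)"])
      (auto simp: entropy_conservative_flux_def)
  finally show ?thesis
    using GS_conservative assms by (simp add: entropy_conservative_flux_def entropy_var_inner_flux_G)
qed

text \<open>The potential cancels between the exact and the numerical flux. The exact entropy fluxes
  that remain are those produced by the volume term, which enters the scheme with the opposite
  sign.\<close>

lemma surface_F_entropy:
  assumes "\<And>i1. i1 \<le> deg P \<Longrightarrow> W i j i1 j1 \<in> admissible"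
  shows "(\<Sum>i1=0..deg P. wt P i1 * (entropy_var (W i j i1 j1) \<bullet>
      ((2 / dx P * (tau (deg P) i1 / wt P i1)) *\<^sub>R (flux_F (W i j i1 j1) - F_star P W i j i1 j1))))
    = 2 / dx P * ((entropy_flux_F (W i j (deg P) j1) - entropy_F_star P W i j (deg P) j1)
        - (entropy_flux_F (W i j 0 j1) - entropy_F_star P W i j 0 j1))"
  unfolding sum_surface_term[OF quadrature degree]
  using assms by (simp add: inner_diff_right entropy_var_inner_flux_F entropy_F_star_def)

lemma surface_G_entropy:
  assumes "\<And>j1. j1 \<le> deg P \<Longrightarrow> W i j i1 j1 \<in> admissible"
  shows "(\<Sum>j1=0..deg P. wt P j1 * (entropy_var (W i j i1 j1) \<bullet>
      ((2 / dy P * (tau (deg P) j1 / wt P j1)) *\<^sub>R (flux_G (W i j i1 j1) - G_star P W i j i1 j1))))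
    = 2 / dy P * ((entropy_flux_G (W i j i1 (deg P)) - entropy_G_star P W i j i1 (deg P))
        - (entropy_flux_G (W i j i1 0) - entropy_G_star P W i j i1 0))"
  unfolding sum_surface_term[OF quadrature degree]
  using assms by (simp add: inner_diff_right entropy_var_inner_flux_G entropy_G_star_def)

section \<open>Tensor-product quadrature over one cell and the source correction\<close>

abbreviation cell_sum :: "(nat \<Rightarrow> nat \<Rightarrow> real) \<Rightarrow> real" where
  "cell_sum g \<equiv> \<Sum>i1=0..deg P. \<Sum>j1=0..deg P. wt P i1 * wt P j1 * g i1 j1"

text \<open>The identities in \<open>y\<close> hold for each fixed \<open>i1\<close> and those in
  \<open>x\<close> for each fixed \<open>j1\<close>; this grouping and the next one serve these two
  cases.\<close>

lemma cell_sum_rows: "cell_sum g = (\<Sum>i1=0..deg P. wt P i1 * (\<Sum>j1=0..deg P. wt P j1 * g i1 j1))"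
  by (simp add: sum_distrib_left mult_ac)

lemma cell_sum_columns: "cell_sum g = (\<Sum>j1=0..deg P. wt P j1 * (\<Sum>i1=0..deg P. wt P i1 * g i1 j1))"
  by (subst sum.swap) (simp add: sum_distrib_left mult_ac)

lemma cell_sum_add: "cell_sum (\<lambda>i1 j1. g i1 j1 + h i1 j1) = cell_sum g + cell_sum h"
  by (simp add: distrib_left sum.distrib)

lemma cell_sum_diff: "cell_sum (\<lambda>i1 j1. g i1 j1 - h i1 j1) = cell_sum g - cell_sum h"
  by (simp add: right_diff_distrib sum_subtractf)

lemma cell_sum_scale: "cell_sum (\<lambda>i1 j1. c * g i1 j1) = c * cell_sum g"
  by (simp add: sum_distrib_left mult_ac)

text \<open>The factor 4 is the area of the reference square and matches the normalisation by 4 in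
  \<open>mean_var\<close>.\<close>

lemma cell_sum_const: "cell_sum (\<lambda>_ _. c) = 4 * c"
proof -
  have "cell_sum (\<lambda>_ _. c) = (\<Sum>i=0..deg P. wt P i) * (\<Sum>i=0..deg P. wt P i) * c"
    unfolding sum_product by (simp only: sum_distrib_right)
  then show ?thesis
    by (simp add: gauss_lobatto_weight_sum[OF quadrature])
qed

lemma cell_sum_entropy_var_inner:
  "cell_sum (\<lambda>i1 j1. entropy_var (W i j i1 j1) \<bullet> x) = 4 * (mean_var P W i j \<bullet> x)"
  by (simp add: mean_var_def inner_sum_left sum_distrib_left)

text \<open>Deviations from the mean have zero weighted sum, so testing against \<open>V\<close> or against
  \<open>V - mean\<close> is the same and \<open>sigma_den\<close> appears.\<close>

lemma cell_sum_source_corr: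
  assumes "correction_solvable P W i j"
  shows "cell_sum (\<lambda>i1 j1. entropy_var (W i j i1 j1) \<bullet> source_corr P W i j i1 j1) = sigma_num P W i j"
proof (cases "sigma_den P W i j = 0")
  case True
  then show ?thesis
    using assms by (simp add: correction_solvable_def source_corr_def)
next
  case False
  let ?V = "\<lambda>i1 j1. entropy_var (W i j i1 j1)" and ?m = "mean_var P W i j"
  have "cell_sum (\<lambda>i1 j1. ?V i1 j1 \<bullet> (?V i1 j1 - ?m))
      = cell_sum (\<lambda>i1 j1. (norm (?V i1 j1 - ?m))\<^sup>2 + (?V i1 j1 \<bullet> ?m - ?m \<bullet> ?m))"
    by (intro sum.cong refl arg_cong2[of _ _ _ _ "(*)"])
      (simp add: power2_norm_eq_inner inner_diff inner_commute)
  \<comment> \<open>The bracketed remainder sums to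
    \<open>4 * (?m \<bullet> ?m) - 4 * (?m \<bullet> ?m)\<close>, which is zero.\<close>
  also have "\<dots> = sigma_den P W i j"
    unfolding cell_sum_add cell_sum_diff cell_sum_entropy_var_inner cell_sum_const sigma_den_def by simp
  finally have "cell_sum (\<lambda>i1 j1. ?V i1 j1 \<bullet> (?V i1 j1 - ?m)) = sigma_den P W i j" .
  moreover have "cell_sum (\<lambda>i1 j1. ?V i1 j1 \<bullet> source_corr P W i j i1 j1)
      = sigma_num P W i j / sigma_den P W i j * cell_sum (\<lambda>i1 j1. ?V i1 j1 \<bullet> (?V i1 j1 - ?m))"
    unfolding cell_sum_scale[symmetric] using False by (simp add: source_corr_def)
  ultimately show ?thesis
    using False by simp
qed

text \<open>The terms separate by direction. In each one, surface minus volume leaves the numerical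
  entropy fluxes, and the equilibrium volume term supplies the exact equilibrium fluxes.\<close>

lemma cell_sum_dg_rhs:
  assumes W: "\<And>i1 j1. i1 \<le> deg P \<Longrightarrow> j1 \<le> deg P \<Longrightarrow> W i j i1 j1 \<in> admissible"
    and We: "\<And>i1 j1. i1 \<le> deg P \<Longrightarrow> j1 \<le> deg P \<Longrightarrow> eq_nodal P i j i1 j1 \<in> admissible"
    and solvable: "correction_solvable P W i j"
  shows "cell_sum (\<lambda>i1 j1. entropy_var (W i j i1 j1) \<bullet> dg_rhs P W i j i1 j1) =
    2 / dx P * (\<Sum>j1=0..deg P. wt P j1 *
      ((entropy_flux_F (eq_nodal P i j (deg P) j1) - entropy_flux_F (eq_nodal P i j 0 j1))
       - (entropy_F_star P W i j (deg P) j1 - entropy_F_star P W i j 0 j1))) +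
    2 / dy P * (\<Sum>i1=0..deg P. wt P i1 *
      ((entropy_flux_G (eq_nodal P i j i1 (deg P)) - entropy_flux_G (eq_nodal P i j i1 0))
       - (entropy_G_star P W i j i1 (deg P) - entropy_G_star P W i j i1 0)))"
proof -
  let ?V = "\<lambda>i1 j1. entropy_var (W i j i1 j1)" and ?Ve = "\<lambda>i1 j1. entropy_var (eq_nodal P i j i1 j1)"
  let ?volF = "\<lambda>i1 j1. ?V i1 j1 \<bullet> volume_F P W i j i1 j1"
  let ?volG = "\<lambda>i1 j1. ?V i1 j1 \<bullet> volume_G P W i j i1 j1"
  let ?surF = "\<lambda>i1 j1. ?V i1 j1 \<bullet> ((2 / dx P * (tau (deg P) i1 / wt P i1))
      *\<^sub>R (flux_F (W i j i1 j1) - F_star P W i j i1 j1))"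
  let ?surG = "\<lambda>i1 j1. ?V i1 j1 \<bullet> ((2 / dy P * (tau (deg P) j1 / wt P j1))
      *\<^sub>R (flux_G (W i j i1 j1) - G_star P W i j i1 j1))"
  let ?S0 = "\<lambda>i1 j1. ?V i1 j1 \<bullet> source0 P i j i1 j1"
  let ?corr = "\<lambda>i1 j1. ?V i1 j1 \<bullet> source_corr P W i j i1 j1"
  let ?S0e = "\<lambda>i1 j1. ?Ve i1 j1 \<bullet> source0 P i j i1 j1"
  let ?eF = "\<lambda>i1 j1. ?Ve i1 j1 \<bullet> volume_F P (eq_nodal P) i j i1 j1"
  let ?eG = "\<lambda>i1 j1. ?Ve i1 j1 \<bullet> volume_G P (eq_nodal P) i j i1 j1"
  have "cell_sum (\<lambda>i1 j1. ?V i1 j1 \<bullet> dg_rhs P W i j i1 j1) =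
      cell_sum (\<lambda>i1 j1. (?surF i1 j1 - ?volF i1 j1) + (?surG i1 j1 - ?volG i1 j1) + (?S0 i1 j1 - ?corr i1 j1))"
    using W by (intro sum.cong refl arg_cong2[of _ _ _ _ "(*)"])
      (simp add: dg_rhs_def inner_add_right inner_diff_right source_nodal_def entropy_var_inner_source)
  also have "\<dots> = (cell_sum ?surF - cell_sum ?volF) + (cell_sum ?surG - cell_sum ?volG)
      + (cell_sum ?S0 - cell_sum ?corr)"
    unfolding cell_sum_add cell_sum_diff ..
  \<comment> \<open>The numerator \<open>sigma_num\<close> tests \<open>source0\<close> against the
    difference of the two entropy variables, so subtracting the correction leaves the test against
    the equilibrium variable.\<close>
  also have "cell_sum ?corr = cell_sum ?S0 - cell_sum ?S0e"
    unfolding cell_sum_source_corr[OF solvable] cell_sum_diff[symmetric] sigma_num_def inner_diff_left ..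
  also have "cell_sum ?S0e = cell_sum (\<lambda>i1 j1. ?eF i1 j1 + ?eG i1 j1)"
    using We by (intro sum.cong refl arg_cong2[of _ _ _ _ "(*)"])
      (simp add: source0_def inner_add_right inner_diff_right source_nodal_def entropy_var_inner_source)
  also have "\<dots> = cell_sum ?eF + cell_sum ?eG"
    by (rule cell_sum_add)
  finally have "cell_sum (\<lambda>i1 j1. ?V i1 j1 \<bullet> dg_rhs P W i j i1 j1) =
      (cell_sum ?surF - cell_sum ?volF + cell_sum ?eF) + (cell_sum ?surG - cell_sum ?volG + cell_sum ?eG)"
    by simp
  moreover have "cell_sum ?surF - cell_sum ?volF + cell_sum ?eF =
    2 / dx P * (\<Sum>j1=0..deg P. wt P j1 *
      ((entropy_flux_F (eq_nodal P i j (deg P) j1) - entropy_flux_F (eq_nodal P i j 0 j1))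
       - (entropy_F_star P W i j (deg P) j1 - entropy_F_star P W i j 0 j1)))"
  proof -
    have "cell_sum ?volF =
          (\<Sum>j1=0..deg P. wt P j1 * (2 / dx P * (entropy_flux_F (W i j (deg P) j1) - entropy_flux_F (W i j 0 j1))))"
        "cell_sum ?eF =
          (\<Sum>j1=0..deg P. wt P j1 * (2 / dx P * (entropy_flux_F (eq_nodal P i j (deg P) j1) - entropy_flux_F (eq_nodal P i j 0 j1))))"
        "cell_sum ?surF =
          (\<Sum>j1=0..deg P. wt P j1 * (2 / dx P * ((entropy_flux_F (W i j (deg P) j1) - entropy_F_star P W i j (deg P) j1)
          - (entropy_flux_F (W i j 0 j1) - entropy_F_star P W i j 0 j1))))"
      unfolding cell_sum_columns
      by (intro sum.cong refl arg_cong2[of _ _ _ _ "(*)"] volume_F_entropy surface_F_entropy W We; simp)+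
    then show ?thesis
      by (simp add: sum_distrib_left sum_subtractf sum.distrib algebra_simps)
  qed
  moreover have "cell_sum ?surG - cell_sum ?volG + cell_sum ?eG =
    2 / dy P * (\<Sum>i1=0..deg P. wt P i1 *
      ((entropy_flux_G (eq_nodal P i j i1 (deg P)) - entropy_flux_G (eq_nodal P i j i1 0))
       - (entropy_G_star P W i j i1 (deg P) - entropy_G_star P W i j i1 0)))"
  proof -
    have "cell_sum ?volG =
          (\<Sum>i1=0..deg P. wt P i1 * (2 / dy P * (entropy_flux_G (W i j i1 (deg P)) - entropy_flux_G (W i j i1 0))))"
        "cell_sum ?eG =
          (\<Sum>i1=0..deg P. wt P i1 * (2 / dy P * (entropy_flux_G (eq_nodal P i j i1 (deg P)) - entropy_flux_G (eq_nodal P i j i1 0))))"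
        "cell_sum ?surG =
          (\<Sum>i1=0..deg P. wt P i1 * (2 / dy P * ((entropy_flux_G (W i j i1 (deg P)) - entropy_G_star P W i j i1 (deg P))
          - (entropy_flux_G (W i j i1 0) - entropy_G_star P W i j i1 0))))"
      unfolding cell_sum_rows
      by (intro sum.cong refl arg_cong2[of _ _ _ _ "(*)"] volume_G_entropy surface_G_entropy W We; simp)+
    then show ?thesis
      by (simp add: sum_distrib_left sum_subtractf sum.distrib algebra_simps)
  qed
  ultimately show ?thesis by simp
qed

end

section \<open>Global balance\<close>

text \<open>Regroup by faces: with \<open>a i\<close> at the right and \<open>b i\<close> at the
  left face of cell \<open>i\<close>, the two values at each interior face are paired, and the two
  outermost faces form the last pair.\<close>

lemma interface_sum_nonneg:
  fixes a b :: "nat \<Rightarrow> real"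
  assumes N: "1 \<le> N" and interior: "\<And>i. 1 \<le> i \<Longrightarrow> i < N \<Longrightarrow> b (Suc i) \<le> a i"
    and ends: "b 1 \<le> a N"
  shows "0 \<le> (\<Sum>i=1..N. a i - b i)"
proof -
  have "{1..N} = insert 1 {Suc 1..<Suc N}" using N by auto
  then have "(\<Sum>i=1..N. b i) = b 1 + (\<Sum>i=1..<N. b (Suc i))"
    using sum.shift_bounds_Suc_ivl[of b 1 N] by (simp del: sum.op_ivl_Suc)
  moreover have "{1..N} = insert N {1..<N}" using N by auto
  then have "(\<Sum>i=1..N. a i) = a N + (\<Sum>i=1..<N. a i)" by simp
  moreover have "(\<Sum>i=1..<N. b (Suc i)) \<le> (\<Sum>i=1..<N. a i)"
    by (intro sum_mono) (use interior in auto)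
  ultimately show ?thesis using ends by (simp add: sum_subtractf)
qed

lemma sum_backward_differences:
  fixes g :: "nat \<Rightarrow> real"
  shows "(\<Sum>i=1..N. g i - g (i - 1)) = g N - g 0"
  by (induction N) auto

text \<open>With \<open>h\<close> the cell width, the coordinate is \<open>a + h * c\<close> for
  \<open>c = i - 1/2 + x / 2\<close>, which lies between 0 and \<open>N\<close>.\<close>

lemma cell_scaled_coordinate_mem:
  fixes a b x :: real
  assumes "a < b" "i \<in> {1..N}" "-1 \<le> x" "x \<le> 1"
  shows "(a + (real i - 1/2) * ((b - a) / real N)) + (b - a) / real N / 2 * x \<in> {a..b}"
proof -
  let ?h = "(b - a) / real N" and ?c = "real i - 1/2 + x / 2"
  have h: "?h > 0" "?h * real N = b - a" using assms by auto
  have "real i \<ge> 1" "real i \<le> real N" using assms by auto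
  then have c: "0 \<le> ?c" "?c \<le> real N" using assms by auto
  have "0 \<le> ?h * ?c" "?h * ?c \<le> ?h * real N"
    using c h(1) by (auto intro: mult_nonneg_nonneg mult_left_mono simp del: times_divide_eq_left)
  moreover have "(a + (real i - 1/2) * ?h) + ?h / 2 * x = a + ?h * ?c"
    by (simp add: algebra_simps add_divide_distrib)
  ultimately show ?thesis using h(2) by simp
qed

text \<open>Rearranged stability: it compares the numerical entropy flux of one shared face as read
  from its two sides.\<close>

lemma entropy_stable_flux_jump:
  assumes "entropy_stable_flux psi fh" "UL \<in> admissible" "UR \<in> admissible"
  shows "entropy_var UR \<bullet> fh UL UR - psi UR \<le> entropy_var UL \<bullet> fh UL UR - psi UL"
  using assms by (force simp: entropy_stable_flux_def inner_diff_left)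

context dg_scheme
begin

section \<open>End nodes as faces, and signs of the summed boundary fluxes\<close>

lemma x_node_last: "x_node P i (deg P) = x_face P i"
  by (simp add: x_node_def x_face_def gauss_lobatto_endpoints[OF quadrature] algebra_simps)

text \<open>The hypothesis makes the truncated subtraction \<open>i - 1\<close> agree with the real
  one.\<close>

lemma x_node_0: "i \<ge> 1 \<Longrightarrow> x_node P i 0 = x_face P (i - 1)"
  by (simp add: x_node_def x_face_def gauss_lobatto_endpoints[OF quadrature] of_nat_diff algebra_simps)

lemma y_node_last: "y_node P j (deg P) = y_face P j"
  by (simp add: y_node_def y_face_def gauss_lobatto_endpoints[OF quadrature] algebra_simps)

lemma y_node_0: "j \<ge> 1 \<Longrightarrow> y_node P j 0 = y_face P (j - 1)"
  by (simp add: y_node_def y_face_def gauss_lobatto_endpoints[OF quadrature] of_nat_diff algebra_simps)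

lemma x_node_mem:
  assumes "xa P < xb P" "i \<in> {1..Nx P}" "q \<le> deg P"
  shows "x_node P i q \<in> {xa P..xb P}"
  unfolding x_node_def dx_def using assms gauss_lobatto_node_bounds[OF quadrature]
  by (intro cell_scaled_coordinate_mem) auto

lemma y_node_mem:
  assumes "yc P < yd P" "j \<in> {1..Ny P}" "q \<le> deg P"
  shows "y_node P j q \<in> {yc P..yd P}"
  unfolding y_node_def dy_def using assms gauss_lobatto_node_bounds[OF quadrature]
  by (intro cell_scaled_coordinate_mem) auto

text \<open>Neighbouring cells use the same Lax-Friedrichs flux at their common face, so the jump
  inequality applies there.\<close>

lemma entropy_F_star_sum_nonneg:
  assumes stable: "entropy_stable_flux potential_F (lax_friedrichs flux_F (alpha_F P))"
    and mesh: "Nx P \<ge> 1" and j: "j \<in> {1..Ny P}" and j1: "j1 \<le> deg P"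
    and W: "\<And>i i1. i \<in> {1..Nx P} \<Longrightarrow> i1 \<le> deg P \<Longrightarrow> W i j i1 j1 \<in> admissible"
    and bc: "periodic_bc P W \<or> compact_bc P W"
  shows "0 \<le> (\<Sum>i=1..Nx P. entropy_F_star P W i j (deg P) j1 - entropy_F_star P W i j 0 j1)"
proof (rule interface_sum_nonneg[OF mesh])
  fix i assume "1 \<le> i" "i < Nx P"
  then have "W i j (deg P) j1 \<in> admissible" "W (Suc i) j 0 j1 \<in> admissible"
    by (auto intro!: W)
  from entropy_stable_flux_jump[OF stable this]
  show "entropy_F_star P W (Suc i) j 0 j1 \<le> entropy_F_star P W i j (deg P) j1"
    using degree by (simp add: entropy_F_star_def F_star_def)
next
  have adm: "W (Nx P) j (deg P) j1 \<in> admissible" "W 1 j 0 j1 \<in> admissible"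
    using mesh by (auto intro!: W)
  show "entropy_F_star P W 1 j 0 j1 \<le> entropy_F_star P W (Nx P) j (deg P) j1"
    using bc
  proof
    assume "periodic_bc P W"
    \<comment> \<open>Periodicity identifies the first and the last face: both carry the flux from
      cell \<open>Nx P\<close> into cell 1.\<close>
    then have "W 0 j (deg P) j1 = W (Nx P) j (deg P) j1" "W (Nx P + 1) j 0 j1 = W 1 j 0 j1"
      using j j1 unfolding periodic_bc_def by auto
    with entropy_stable_flux_jump[OF stable adm] show ?thesis
      using degree by (simp add: entropy_F_star_def F_star_def)
  next
    assume "compact_bc P W"
    then show ?thesis using j j1 unfolding compact_bc_def by auto
  qed
qed

lemma entropy_G_star_sum_nonneg:
  assumes stable: "entropy_stable_flux potential_G (lax_friedrichs flux_G (alpha_G P))"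
    and mesh: "Ny P \<ge> 1" and i: "i \<in> {1..Nx P}" and i1: "i1 \<le> deg P"
    and W: "\<And>j j1. j \<in> {1..Ny P} \<Longrightarrow> j1 \<le> deg P \<Longrightarrow> W i j i1 j1 \<in> admissible"
    and bc: "periodic_bc P W \<or> compact_bc P W"
  shows "0 \<le> (\<Sum>j=1..Ny P. entropy_G_star P W i j i1 (deg P) - entropy_G_star P W i j i1 0)"
proof (rule interface_sum_nonneg[OF mesh])
  fix j assume "1 \<le> j" "j < Ny P"
  then have "W i j i1 (deg P) \<in> admissible" "W i (Suc j) i1 0 \<in> admissible"
    by (auto intro!: W)
  from entropy_stable_flux_jump[OF stable this]
  show "entropy_G_star P W i (Suc j) i1 0 \<le> entropy_G_star P W i j i1 (deg P)"
    using degree by (simp add: entropy_G_star_def G_star_def)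
next
  have adm: "W i (Ny P) i1 (deg P) \<in> admissible" "W i 1 i1 0 \<in> admissible"
    using mesh by (auto intro!: W)
  show "entropy_G_star P W i 1 i1 0 \<le> entropy_G_star P W i (Ny P) i1 (deg P)"
    using bc
  proof
    assume "periodic_bc P W"
    then have "W i 0 i1 (deg P) = W i (Ny P) i1 (deg P)" "W i (Ny P + 1) i1 0 = W i 1 i1 0"
      using i i1 unfolding periodic_bc_def by auto
    with entropy_stable_flux_jump[OF stable adm] show ?thesis
      using degree by (simp add: entropy_G_star_def G_star_def)
  next
    assume "compact_bc P W"
    then show ?thesis using i i1 unfolding compact_bc_def by auto
  qed
qed

text \<open>The sum telescopes to the values at the two vertical sides, which are equal under
  periodicity and zero under compact support.\<close>

lemma equilibrium_flux_F_sum: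
  assumes "Nx P \<ge> 1" "y \<in> {yc P..yd P}" "periodic_bc P W \<or> compact_bc P W"
  shows "(\<Sum>i=1..Nx P. entropy_flux_F (Ueq P (x_face P i) y) - entropy_flux_F (Ueq P (x_face P (i - 1)) y)) = 0"
proof -
  have "x_face P 0 = xa P" "x_face P (Nx P) = xb P"
    using assms(1) by (auto simp: x_face_def dx_def)
  then show ?thesis
    using assms(2,3) sum_backward_differences[of "\<lambda>i. entropy_flux_F (Ueq P (x_face P i) y)"]
    by (auto simp: periodic_bc_def compact_bc_def)
qed

lemma equilibrium_flux_G_sum:
  assumes "Ny P \<ge> 1" "x \<in> {xa P..xb P}" "periodic_bc P W \<or> compact_bc P W"
  shows "(\<Sum>j=1..Ny P. entropy_flux_G (Ueq P x (y_face P j)) - entropy_flux_G (Ueq P x (y_face P (j - 1)))) = 0"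
proof -
  have "y_face P 0 = yc P" "y_face P (Ny P) = yd P"
    using assms(1) by (auto simp: y_face_def dy_def)
  then show ?thesis
    using assms(2,3) sum_backward_differences[of "\<lambda>j. entropy_flux_G (Ueq P x (y_face P j))"]
    by (auto simp: periodic_bc_def compact_bc_def)
qed

section \<open>Entropy rates of the cells and their sum\<close>

abbreviation rate_F :: "nodal \<Rightarrow> nat \<Rightarrow> nat \<Rightarrow> nat \<Rightarrow> real" where
  "rate_F W i j j1 \<equiv>
    (entropy_flux_F (Ueq P (x_face P i) (y_node P j j1))
      - entropy_flux_F (Ueq P (x_face P (i - 1)) (y_node P j j1)))
    - (entropy_F_star P W i j (deg P) j1 - entropy_F_star P W i j 0 j1)"

abbreviation rate_G :: "nodal \<Rightarrow> nat \<Rightarrow> nat \<Rightarrow> nat \<Rightarrow> real" where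
  "rate_G W i j i1 \<equiv>
    (entropy_flux_G (Ueq P (x_node P i i1) (y_face P j))
      - entropy_flux_G (Ueq P (x_node P i i1) (y_face P (j - 1))))
    - (entropy_G_star P W i j i1 (deg P) - entropy_G_star P W i j i1 0)"

text \<open>The outcome of \<open>cell_sum_dg_rhs\<close> times the Jacobian
  \<open>dx P * dy P / 4\<close>, which turns \<open>2 / dx P\<close> into \<open>dy P / 2\<close>
  and \<open>2 / dy P\<close> into \<open>dx P / 2\<close>.\<close>

definition cell_rate :: "nodal \<Rightarrow> nat \<Rightarrow> nat \<Rightarrow> real" where
  "cell_rate W i j = dy P / 2 * (\<Sum>j1=0..deg P. wt P j1 * rate_F W i j j1)
    + dx P / 2 * (\<Sum>i1=0..deg P. wt P i1 * rate_G W i j i1)"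

lemma has_real_derivative_cell_entropy:
  assumes domain: "xa P < xb P" "yc P < yd P"
    and equilibrium: "steady_state (xa P) (xb P) (yc P) (yd P) gx gy (Ueq P)"
    and solution: "dg_solution P T U" and t: "t \<in> T"
    and i: "i \<in> {1..Nx P}" and j: "j \<in> {1..Ny P}"
    and solvable: "correction_solvable P (U t) i j"
  shows "((\<lambda>s. dx P * dy P / 4 * cell_sum (\<lambda>i1 j1. entropy (U s i j i1 j1)))
    has_real_derivative cell_rate (U t) i j) (at t within T)"
proof -
  have W: "U t i j i1 j1 \<in> admissible"
    and U': "((\<lambda>s. U s i j i1 j1) has_vector_derivative dg_rhs P (U t) i j i1 j1) (at t within T)"
    if "i1 \<le> deg P" "j1 \<le> deg P" for i1 j1
    using solution t i j that by (auto simp: dg_solution_def)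
  have We: "eq_nodal P i j i1 j1 \<in> admissible" if "i1 \<le> deg P" "j1 \<le> deg P" for i1 j1
    using equilibrium x_node_mem[OF domain(1) i that(1)] y_node_mem[OF domain(2) j that(2)]
    by (simp add: steady_state_def eq_nodal_def)
  have h: "dx P > 0" "dy P > 0"
    using domain i j by (auto simp: dx_def dy_def)
  have "((\<lambda>s. dx P * dy P / 4 * cell_sum (\<lambda>i1 j1. entropy (U s i j i1 j1))) has_real_derivative
      dx P * dy P / 4 * cell_sum (\<lambda>i1 j1. entropy_var (U t i j i1 j1) \<bullet> dg_rhs P (U t) i j i1 j1))
      (at t within T)"
    by (intro DERIV_cmult DERIV_sum has_real_derivative_entropy W U') auto
  also have "dx P * dy P / 4 * cell_sum (\<lambda>i1 j1. entropy_var (U t i j i1 j1) \<bullet> dg_rhs P (U t) i j i1 j1)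
      = cell_rate (U t) i j"
    using i j h
    by (subst cell_sum_dg_rhs[where W = "U t", OF W We solvable])
      (simp_all add: eq_nodal_def x_node_last x_node_0 y_node_last y_node_0 cell_rate_def distrib_left)
  finally show ?thesis .
qed

lemma sum_cell_rate_nonpos:
  assumes domain: "xa P < xb P" "yc P < yd P" and mesh: "Nx P \<ge> 1" "Ny P \<ge> 1"
    and stable: "entropy_stable_flux potential_F (lax_friedrichs flux_F (alpha_F P))"
      "entropy_stable_flux potential_G (lax_friedrichs flux_G (alpha_G P))"
    and W: "\<And>i j i1 j1. i \<in> {1..Nx P} \<Longrightarrow> j \<in> {1..Ny P} \<Longrightarrow> i1 \<le> deg P \<Longrightarrow> j1 \<le> deg P
      \<Longrightarrow> W i j i1 j1 \<in> admissible"
    and bc: "periodic_bc P W \<or> compact_bc P W"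
  shows "(\<Sum>i=1..Nx P. \<Sum>j=1..Ny P. cell_rate W i j) \<le> 0"
proof -
  have wt: "wt P q \<ge> 0" if "q \<le> deg P" for q
    using gauss_lobatto_weight_pos[OF quadrature degree that] by simp
  have "(\<Sum>i=1..Nx P. \<Sum>j=1..Ny P. \<Sum>j1=0..deg P. wt P j1 * rate_F W i j j1)
      = (\<Sum>j=1..Ny P. \<Sum>j1=0..deg P. wt P j1 * (\<Sum>i=1..Nx P. rate_F W i j j1))"
    \<comment> \<open>The sum over \<open>i\<close> moves innermost, so that the fluxes are summed
      along one horizontal line of nodes with a common nonnegative weight.\<close>
    by (subst sum.swap, rule sum.cong[OF refl], subst sum.swap) (simp add: sum_distrib_left)
  also have "\<dots> \<le> 0"
  proof (rule sum_nonpos, rule sum_nonpos, rule mult_nonneg_nonpos)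
    fix j j1 assume "j \<in> {1..Ny P}" "j1 \<in> {0..deg P}"
    then show "(\<Sum>i=1..Nx P. rate_F W i j j1) \<le> 0"
      using entropy_F_star_sum_nonneg[of j j1 W] equilibrium_flux_F_sum[of "y_node P j j1" W]
        y_node_mem[OF domain(2), of j j1] stable mesh W bc
      by (simp add: sum_subtractf)
  qed (use wt in auto)
  finally have F: "(\<Sum>i=1..Nx P. \<Sum>j=1..Ny P. \<Sum>j1=0..deg P. wt P j1 * rate_F W i j j1) \<le> 0" .
  have "(\<Sum>i=1..Nx P. \<Sum>j=1..Ny P. \<Sum>i1=0..deg P. wt P i1 * rate_G W i j i1)
      = (\<Sum>i=1..Nx P. \<Sum>i1=0..deg P. wt P i1 * (\<Sum>j=1..Ny P. rate_G W i j i1))"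
    by (rule sum.cong[OF refl], subst sum.swap) (simp add: sum_distrib_left)
  also have "\<dots> \<le> 0"
  proof (rule sum_nonpos, rule sum_nonpos, rule mult_nonneg_nonpos)
    fix i i1 assume "i \<in> {1..Nx P}" "i1 \<in> {0..deg P}"
    then show "(\<Sum>j=1..Ny P. rate_G W i j i1) \<le> 0"
      using entropy_G_star_sum_nonneg[of i i1 W] equilibrium_flux_G_sum[of "x_node P i i1" W]
        x_node_mem[OF domain(1), of i i1] stable mesh W bc
      by (simp add: sum_subtractf)
  qed (use wt in auto)
  finally have G: "(\<Sum>i=1..Nx P. \<Sum>j=1..Ny P. \<Sum>i1=0..deg P. wt P i1 * rate_G W i j i1) \<le> 0" .
  have "(\<Sum>i=1..Nx P. \<Sum>j=1..Ny P. cell_rate W i j)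
      = dy P / 2 * (\<Sum>i=1..Nx P. \<Sum>j=1..Ny P. \<Sum>j1=0..deg P. wt P j1 * rate_F W i j j1)
      + dx P / 2 * (\<Sum>i=1..Nx P. \<Sum>j=1..Ny P. \<Sum>i1=0..deg P. wt P i1 * rate_G W i j i1)"
    by (simp only: cell_rate_def sum.distrib sum_distrib_left)
  also have "\<dots> \<le> 0"
    using F G domain by (intro add_nonpos_nonpos mult_nonneg_nonpos) (auto simp: dx_def dy_def)
  finally show ?thesis .
qed

end

theorem theorem4p4:
  fixes P :: dg_data and phi :: "real \<Rightarrow> real \<Rightarrow> real"
    and T :: "real set" and U :: "real \<Rightarrow> nodal"
  assumes domain: "xa P < xb P" "yc P < yd P"
    and mesh: "Nx P \<ge> 1" "Ny P \<ge> 1"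
    and degree: "deg P \<ge> 1"
    and quadrature: "gauss_lobatto (deg P) (node P) (wt P)"
    and potential: "partial_derivatives (xa P) (xb P) (yc P) (yd P) phi (phi_x P) (phi_y P)"
    and equilibrium: "steady_state (xa P) (xb P) (yc P) (yd P) (phi_x P) (phi_y P) (Ueq P)"
    and conservative: "entropy_conservative_flux flux_F potential_F (FS P)"
      "entropy_conservative_flux flux_G potential_G (GS P)"
    and stable: "entropy_stable_flux potential_F (lax_friedrichs flux_F (alpha_F P))"
      "entropy_stable_flux potential_G (lax_friedrichs flux_G (alpha_G P))"
    and time: "is_interval T" "interior T \<noteq> {}"
    and solution: "dg_solution P T U"
    and boundary: "(\<forall>t\<in>T. periodic_bc P (U t)) \<or> (\<forall>t\<in>T. compact_bc P (U t))"
  shows "(\<forall>t\<in>T. \<forall>i\<in>{1..Nx P}. \<forall>j\<in>{1..Ny P}. correction_solvable P (U t) i j \<longrightarrow>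
      ((\<lambda>s. dx P * dy P / 4 *
          (\<Sum>i1=0..deg P. \<Sum>j1=0..deg P. wt P i1 * wt P j1 * entropy (U s i j i1 j1)))
        has_real_derivative
          - (dy P / 2) * (\<Sum>j1=0..deg P. wt P j1 *
              (entropy_F_star P (U t) i j (deg P) j1 - entropy_F_star P (U t) i j 0 j1))
          + dy P / 2 * (\<Sum>j1=0..deg P. wt P j1 *
              (entropy_flux_F (Ueq P (x_face P i) (y_node P j j1))
               - entropy_flux_F (Ueq P (x_face P (i - 1)) (y_node P j j1))))
          - dx P / 2 * (\<Sum>i1=0..deg P. wt P i1 *
              (entropy_G_star P (U t) i j i1 (deg P) - entropy_G_star P (U t) i j i1 0))
          + dx P / 2 * (\<Sum>i1=0..deg P. wt P i1 *
              (entropy_flux_G (Ueq P (x_node P i i1) (y_face P j))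
               - entropy_flux_G (Ueq P (x_node P i i1) (y_face P (j - 1))))))
        (at t within T)) \<and>
    (\<forall>t\<in>T. (\<forall>i\<in>{1..Nx P}. \<forall>j\<in>{1..Ny P}. correction_solvable P (U t) i j) \<longrightarrow>
      (\<exists>E'. ((\<lambda>s. dx P * dy P / 4 *
          (\<Sum>i=1..Nx P. \<Sum>j=1..Ny P. \<Sum>i1=0..deg P. \<Sum>j1=0..deg P.
             wt P i1 * wt P j1 * entropy (U s i j i1 j1)))
        has_real_derivative E') (at t within T) \<and> E' \<le> 0))"
proof -
  interpret dg_scheme P
    using degree quadrature conservative by unfold_locales
  note cell = has_real_derivative_cell_entropy[OF domain equilibrium solution]
  have E: "(\<exists>E'. ((\<lambda>s. dx P * dy P / 4 *
          (\<Sum>i=1..Nx P. \<Sum>j=1..Ny P. \<Sum>i1=0..deg P. \<Sum>j1=0..deg P.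
             wt P i1 * wt P j1 * entropy (U s i j i1 j1)))
        has_real_derivative E') (at t within T) \<and> E' \<le> 0)"
    if t: "t \<in> T" and "\<forall>i\<in>{1..Nx P}. \<forall>j\<in>{1..Ny P}. correction_solvable P (U t) i j" for t
  proof (intro exI conjI)
    show "((\<lambda>s. dx P * dy P / 4 *
          (\<Sum>i=1..Nx P. \<Sum>j=1..Ny P. \<Sum>i1=0..deg P. \<Sum>j1=0..deg P.
             wt P i1 * wt P j1 * entropy (U s i j i1 j1)))
        has_real_derivative (\<Sum>i=1..Nx P. \<Sum>j=1..Ny P. cell_rate (U t) i j)) (at t within T)"
      \<comment> \<open>Fixing the lower bound 1 pushes the area factor through the two cell sums
        but not into the nodal sums, which start at 0; each summand then matches
        \<open>cell\<close>.\<close>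
      unfolding sum_distrib_left[where A = "{1.._}"]
      using that by (intro DERIV_sum cell) auto
    show "(\<Sum>i=1..Nx P. \<Sum>j=1..Ny P. cell_rate (U t) i j) \<le> 0"
      using t boundary solution
      by (intro sum_cell_rate_nonpos domain mesh stable) (auto simp: dg_solution_def)
  qed
  show ?thesis
  proof (intro conjI ballI impI E)
    fix t i j
    assume "t \<in> T" "i \<in> {1..Nx P}" "j \<in> {1..Ny P}" "correction_solvable P (U t) i j"
    from cell[OF this] show "((\<lambda>s. dx P * dy P / 4 *
          (\<Sum>i1=0..deg P. \<Sum>j1=0..deg P. wt P i1 * wt P j1 * entropy (U s i j i1 j1)))
        has_real_derivative
          - (dy P / 2) * (\<Sum>j1=0..deg P. wt P j1 *
              (entropy_F_star P (U t) i j (deg P) j1 - entropy_F_star P (U t) i j 0 j1))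
          + dy P / 2 * (\<Sum>j1=0..deg P. wt P j1 *
              (entropy_flux_F (Ueq P (x_face P i) (y_node P j j1))
               - entropy_flux_F (Ueq P (x_face P (i - 1)) (y_node P j j1))))
          - dx P / 2 * (\<Sum>i1=0..deg P. wt P i1 *
              (entropy_G_star P (U t) i j i1 (deg P) - entropy_G_star P (U t) i j i1 0))
          + dx P / 2 * (\<Sum>i1=0..deg P. wt P i1 *
              (entropy_flux_G (Ueq P (x_node P i i1) (y_face P j))
               - entropy_flux_G (Ueq P (x_node P i i1) (y_face P (j - 1))))))
        (at t within T)"
      \<comment> \<open>Only the grouping differs: \<open>cell_rate\<close> keeps equilibrium and
        numerical fluxes in one sum per direction.\<close>
      by (rule DERIV_cong) (simp add: cell_rate_def sum.distrib sum_subtractf algebra_simps)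
  qed auto
qed

end
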